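(* There exist absolute constants $c_1,c_2,c_3>0$ such that the following holds. Let $k:\mathbb N\to\mathbb N$, $p:\mathbb N\to(0,1)$ and $\alpha:\mathbb N\to(0,\infty)$, and let $\{\mathcal G^k(N,p)\}_N$ be any $k$-wise independent random graph. Then, with probability tending to $1$ as $N\to\infty$, $\mathcal G^k(N,p)$ is $(p,\alpha)$-jumbled, whenever either (1) $k\ge 4$, $p(N)=\Omega(1/N)$ (i.e. $p(N)\ge c/N$ for some constant $c>0$ and all large $N$), and $\alpha(N)/(\sqrt{p(N)}\,N^{3/4})\to\infty$; or (2) $k(N)\ge \log N$, $\frac{c_1\log N}{N}\le p(N)\le 1-\frac{c_2\log^4 N}{N}$, and $\alpha(N)\ge c_3\sqrt{p(N)N}$.
   Context: A $k$-wise independent random graph $\{\mathcal G^k(N,p)\}_N$ is a sequence, indexed by $N$, of probability distributions on simple undirected graphs with vertex set $\{1,\dots,N\}$ such that every one of the $\binom N2$ potential edges appears with probability $p(N)$ and the indicator random variables of the appearance of any $k(N)$ potential edges are mutually independent. For vertex sets $U,V$, $e(U,V)$ denotes the number of edges with one endpoint in $U$ and the other in $V$, where edges with both endpoints in $U\cap V$ are counted twice. A graph is $(p,\alpha)$-jumbled if $|e(U,V)-p|U||V||\le \alpha\sqrt{|U||V|}$ for all vertex sets $U,V$. Here $\log$ is the base-2 logarithm. *)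

theory Defs
  imports "HOL-Probability.Probability" "HOL-Library.Landau_Symbols"
begin

text \<open>A simple undirected graph with vertex set \<open>{1..N}\<close> is represented by its edge set, a subset of
  \<open>potential_edges N\<close>.\<close>

definition potential_edges :: "nat \<Rightarrow> nat set set" where
  "potential_edges N = {e. e \<subseteq> {1..N} \<and> card e = 2}"

text \<open>Independence is required for every set of at most \<open>k N\<close> potential edges. When
  \<open>k N \<le> N choose 2\<close>, this is equivalent to requiring it for sets of exactly \<open>k N\<close> edges; when
  \<open>k N\<close> is larger, no such set exists, and the condition here is mutual independence of all edges.\<close>

definition kwise_indep_random_graph ::
    "(nat \<Rightarrow> nat) \<Rightarrow> (nat \<Rightarrow> real) \<Rightarrow> (nat \<Rightarrow> nat set set pmf) \<Rightarrow> bool" where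
  "kwise_indep_random_graph k p G \<longleftrightarrow>
    (\<forall>N. set_pmf (G N) \<subseteq> Pow (potential_edges N) \<and>
         (\<forall>e\<in>potential_edges N. measure_pmf.prob (G N) {E. e \<in> E} = p N) \<and>
         (\<forall>S\<subseteq>potential_edges N. card S \<le> k N \<longrightarrow>
            prob_space.indep_vars (measure_pmf (G N)) (\<lambda>_. borel)
              (\<lambda>e E. indicator E e :: real) S))"

text \<open>The second summand accounts for edges inside \<open>U \<inter> V\<close> being counted twice.\<close>

definition edges_between :: "'a set set \<Rightarrow> 'a set \<Rightarrow> 'a set \<Rightarrow> nat" where
  "edges_between E U V =
    card {e\<in>E. \<exists>u\<in>U. \<exists>v\<in>V. e = {u, v}} + card {e\<in>E. e \<subseteq> U \<inter> V}"

definition jumbled :: "real \<Rightarrow> real \<Rightarrow> 'a set \<Rightarrow> 'a set set \<Rightarrow> bool" where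
  "jumbled p \<alpha> W E \<longleftrightarrow>
    (\<forall>U V. U \<subseteq> W \<longrightarrow> V \<subseteq> W \<longrightarrow>
      \<bar>real (edges_between E U V) - p * real (card U) * real (card V)\<bar>
        \<le> \<alpha> * sqrt (real (card U) * real (card V)))"

end

theory Submission
  imports Defs "HOL-Real_Asymp.Real_Asymp"
begin

text \<open>Let \<open>M\<close> be the adjacency matrix with \<open>p\<close> subtracted off the diagonal. Up to the diagonal
  correction \<open>p * card (U \<inter> V)\<close>, the discrepancy of \<open>U\<close> and \<open>V\<close> is a bilinear form of \<open>M\<close> and hence
  bounded by the trace of \<open>M\<close> to the power \<open>2 * m\<close>, whose expectation is determined by
  \<open>2 * m\<close>-wise independence. Only closed walks that use each of their edges at least twice contribute,
  and a walk with \<open>v\<close> distinct vertices contributes at most \<open>p ^ (v - 1)\<close>.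

  The shapes of such walks are counted by comparison with a matrix of size \<open>2 * m\<close> whose entries are
  independent, bounded and centered, with all higher moments at least \<open>1\<close>. Its norm is of order
  \<open>sqrt m\<close>, so there are at most \<open>(C * m) ^ m\<close> good walks on \<open>2 * m\<close> vertices. It follows that the
  expected trace is at most \<open>N * (C * p * N) ^ m\<close> as soon as \<open>p * N\<close> is at least of order \<open>m\<close>, and
  Markov's inequality then applies with \<open>m = 2\<close> in the first case and \<open>m\<close> of order \<open>log N\<close> in the second.\<close>

subsection \<open>Quadratic forms and traces of powers\<close>

definition ip :: "'a set \<Rightarrow> ('a \<Rightarrow> real) \<Rightarrow> ('a \<Rightarrow> real) \<Rightarrow> real" where
  "ip V x y = (\<Sum>i\<in>V. x i * y i)"

definition mv :: "'a set \<Rightarrow> ('a \<Rightarrow> 'a \<Rightarrow> real) \<Rightarrow> ('a \<Rightarrow> real) \<Rightarrow> 'a \<Rightarrow> real" where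
  "mv V M x i = (\<Sum>j\<in>V. M i j * x j)"

text \<open>Matrices are functions on index pairs and powers are iterated applications of
  \<open>mv\<close>: the \<open>i\<close>-th summand is the \<open>i\<close>-th diagonal entry of
  the power, read off from the image of a basis vector.\<close>

definition power_trace :: "'a set \<Rightarrow> ('a \<Rightarrow> 'a \<Rightarrow> real) \<Rightarrow> nat \<Rightarrow> real" where
  "power_trace V M n = (\<Sum>i\<in>V. (mv V M ^^ n) (indicator {i}) i)"

lemma ip_self_nonneg: "0 \<le> ip V x x"
  unfolding ip_def by (intro sum_nonneg) auto

lemma ip_Cauchy_Schwarz: "(ip V x y)\<^sup>2 \<le> ip V x x * ip V y y"
  using Cauchy_Schwarz_ineq_sum[of x y V] unfolding ip_def power2_eq_square by simp

lemma ip_indicator: "finite V \<Longrightarrow> i \<in> V \<Longrightarrow> ip V (indicator {i}) x = x i"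
  unfolding ip_def by (subst sum.remove[of _ i]) (auto intro!: sum.neutral simp: indicator_def)

lemma ip_mv_commute:
  assumes "\<And>i j. M i j = M j i"
  shows "ip V (mv V M x) y = ip V x (mv V M y)"
proof -
  have "ip V (mv V M x) y = (\<Sum>i\<in>V. \<Sum>j\<in>V. M i j * x j * y i)"
    by (simp add: ip_def mv_def sum_distrib_right)
  also have "\<dots> = (\<Sum>j\<in>V. \<Sum>i\<in>V. M i j * x j * y i)"
    by (rule sum.swap)
  also have "\<dots> = ip V x (mv V M y)"
    by (auto simp: ip_def mv_def sum_distrib_left assms[of _ "_::'a"] mult_ac intro!: sum.cong)
  finally show ?thesis .
qed

lemma ip_mv_funpow:
  assumes "\<And>i j. M i j = M j i"
  shows "ip V ((mv V M ^^ a) x) ((mv V M ^^ b) y) = ip V x ((mv V M ^^ (a + b)) y)"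
proof (induction a arbitrary: b)
  case (Suc a)
  have "ip V ((mv V M ^^ Suc a) x) ((mv V M ^^ b) y) = ip V ((mv V M ^^ a) x) ((mv V M ^^ Suc b) y)"
    using ip_mv_commute[of M V "(mv V M ^^ a) x" "(mv V M ^^ b) y"] assms by simp
  then show ?case
    using Suc[of "Suc b"] by simp
qed simp

text \<open>Symmetry moves half of the factors to the other side of the inner product. In particular
  even traces are nonnegative, as Markov's inequality will require.\<close>

lemma power_trace_even:
  assumes "\<And>i j. M i j = M j i" and "finite V"
  shows "power_trace V M (2 * m) =
    (\<Sum>i\<in>V. ip V ((mv V M ^^ m) (indicator {i})) ((mv V M ^^ m) (indicator {i})))"
  unfolding power_trace_def
  by (intro sum.cong) (simp_all add: ip_mv_funpow assms ip_indicator mult_2)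

text \<open>\<open>\<beta>\<close> is a bound on the squared operator norm, so each diagonal entry
  of the even power is at most \<open>\<beta> ^ m\<close>.\<close>

lemma power_trace_le:
  assumes "\<And>i j. M i j = M j i" and "finite V"
    and \<beta>: "\<And>x. ip V (mv V M x) (mv V M x) \<le> \<beta> * ip V x x" and "0 \<le> \<beta>"
  shows "power_trace V M (2 * m) \<le> real (card V) * \<beta> ^ m"
proof -
  have *: "ip V ((mv V M ^^ m) x) ((mv V M ^^ m) x) \<le> \<beta> ^ m * ip V x x" for x m
  proof (induction m)
    case (Suc m)
    have "ip V ((mv V M ^^ Suc m) x) ((mv V M ^^ Suc m) x) \<le> \<beta> * ip V ((mv V M ^^ m) x) ((mv V M ^^ m) x)"
      using \<beta> by simp
    also have "\<dots> \<le> \<beta> * (\<beta> ^ m * ip V x x)"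
      using Suc \<open>0 \<le> \<beta>\<close> by (rule mult_left_mono)
    finally show ?case by simp
  qed simp
  have "power_trace V M (2 * m) \<le> (\<Sum>i\<in>V. \<beta> ^ m)"
    unfolding power_trace_even[of M, OF assms(1,2)]
    by (intro sum_mono order.trans[OF *]) (simp add: ip_indicator assms)
  then show ?thesis by simp
qed

text \<open>Repeated squaring with Cauchy-Schwarz replaces the spectral theorem; it is the reason why only
  powers of two occur as exponents.\<close>

lemma bilinear_form_power_le_trace:
  assumes sym: "\<And>i j. M i j = M j i" and fin: "finite V"
  shows "(ip V y (mv V M x)) ^ (2 * 2 ^ s)
    \<le> (ip V y y) ^ (2 ^ s) * (ip V x x) ^ (2 ^ s) * power_trace V M (2 * 2 ^ s)"
proof -
  define f where "f j = ip V x ((mv V M ^^ j) x)" for j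
  have f2: "f (2 * j) = ip V ((mv V M ^^ j) x) ((mv V M ^^ j) x)" for j
    by (simp add: f_def ip_mv_funpow sym mult_2)
  have dbl: "f j ^ 2 \<le> ip V x x * f (2 * j)" for j
    unfolding f2 unfolding f_def by (rule ip_Cauchy_Schwarz)
  \<comment> \<open>Log-convexity of the sequence \<open>f\<close>, iterated by doubling. It starts
    at \<open>f 2\<close>, a squared norm, because squaring both sides needs nonnegativity.\<close>
  have pow: "f 2 ^ (2 ^ s) \<le> ip V x x ^ (2 ^ s - 1) * f (2 * 2 ^ s)" for s
  proof (induction s)
    case (Suc s)
    have "f 2 ^ (2 ^ Suc s) = (f 2 ^ (2 ^ s)) ^ 2"
      by (simp add: power_mult[symmetric] mult.commute)
    also have "\<dots> \<le> (ip V x x ^ (2 ^ s - 1) * f (2 * 2 ^ s)) ^ 2"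
      by (intro power_mono Suc zero_le_power) (use f2[of 1] ip_self_nonneg in auto)
    also have "\<dots> = (ip V x x ^ (2 ^ s - 1)) ^ 2 * (f (2 * 2 ^ s)) ^ 2"
      by (simp add: power_mult_distrib)
    also have "\<dots> \<le> (ip V x x ^ (2 ^ s - 1)) ^ 2 * (ip V x x * f (2 * (2 * 2 ^ s)))"
      by (intro mult_left_mono dbl) simp
    also have "\<dots> = ip V x x ^ (2 * (2 ^ s - 1) + 1) * f (2 * 2 ^ Suc s)"
      by (simp add: power_mult[symmetric] mult_ac)
    also have "2 * (2 ^ s - 1) + 1 = (2::nat) ^ Suc s - 1"
    proof -
      have "(1::nat) \<le> 2 ^ s" by simp
      then show ?thesis unfolding power_Suc by linarith
    qed
    finally show ?case .
  qed simp
  \<comment> \<open>Each coordinate of the iterate is the inner product of a column with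
    \<open>x\<close>. Cauchy-Schwarz bounds the squared norm by the squared Hilbert-Schmidt norm,
    which is a trace, times that of \<open>x\<close>.\<close>
  have "f (2 * 2 ^ s) \<le> (\<Sum>i\<in>V. ip V ((mv V M ^^ 2 ^ s) (indicator {i})) ((mv V M ^^ 2 ^ s) (indicator {i})) * ip V x x)"
    unfolding f2 ip_def[of V "(mv V M ^^ 2 ^ s) x"]
  proof (intro sum_mono)
    fix i assume "i \<in> V"
    then have "(mv V M ^^ 2 ^ s) x i = ip V ((mv V M ^^ 2 ^ s) (indicator {i})) x"
      using ip_mv_funpow[of M V "2 ^ s" "indicator {i}" 0 x, OF sym] fin by (simp add: ip_indicator)
    then show "(mv V M ^^ 2 ^ s) x i * (mv V M ^^ 2 ^ s) x i
      \<le> ip V ((mv V M ^^ 2 ^ s) (indicator {i})) ((mv V M ^^ 2 ^ s) (indicator {i})) * ip V x x"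
      using ip_Cauchy_Schwarz[of V "(mv V M ^^ 2 ^ s) (indicator {i})" x] by (simp add: power2_eq_square)
  qed
  also have "\<dots> = ip V x x * power_trace V M (2 * 2 ^ s)"
    unfolding power_trace_even[of M, OF sym fin] by (simp add: sum_distrib_left mult.commute)
  finally have fin: "f (2 * 2 ^ s) \<le> ip V x x * power_trace V M (2 * 2 ^ s)" .
  have "(ip V y (mv V M x)) ^ (2 * 2 ^ s) = ((ip V y (mv V M x))\<^sup>2) ^ (2 ^ s)"
    by (rule power_mult)
  also have "\<dots> \<le> (ip V y y * f 2) ^ (2 ^ s)"
    using ip_Cauchy_Schwarz[of V y "mv V M x"] f2[of 1] by (intro power_mono) auto
  also have "\<dots> = ip V y y ^ (2 ^ s) * f 2 ^ (2 ^ s)"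
    by (simp add: power_mult_distrib)
  also have "\<dots> \<le> ip V y y ^ (2 ^ s) * (ip V x x ^ (2 ^ s - 1) * (ip V x x * power_trace V M (2 * 2 ^ s)))"
    by (intro mult_left_mono order.trans[OF pow] fin) (auto intro!: zero_le_power ip_self_nonneg)
  also have "\<dots> = ip V y y ^ (2 ^ s) * ip V x x ^ (Suc (2 ^ s - 1)) * power_trace V M (2 * 2 ^ s)"
    by (simp only: power_Suc mult_ac)
  also have "Suc (2 ^ s - 1) = (2::nat) ^ s"
    by simp
  finally show ?thesis .
qed

subsection \<open>Closed walks\<close>

text \<open>A closed walk of length \<open>n\<close> is the list of its first \<open>n\<close> vertices; the last step returns to
  the head of the list, whence the indices \<open>Suc i mod n\<close>.\<close>

definition closed_walks :: "'a set \<Rightarrow> nat \<Rightarrow> 'a list set" where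
  "closed_walks V n = {w. set w \<subseteq> V \<and> length w = n}"

lemma finite_closed_walks: "finite V \<Longrightarrow> finite (closed_walks V n)"
  unfolding closed_walks_def by (rule finite_lists_length_eq)

lemma closed_walks_0: "closed_walks V 0 = {[]}"
  by (auto simp: closed_walks_def)

lemma sum_closed_walks_Suc:
  assumes "finite V"
  shows "(\<Sum>w\<in>closed_walks V (Suc n). f w) = (\<Sum>v\<in>V. \<Sum>w\<in>closed_walks V n. f (v # w))"
proof -
  have "(\<Sum>w\<in>closed_walks V (Suc n). f w) = (\<Sum>(v, w)\<in>V \<times> closed_walks V n. f (v # w))"
    by (rule sum.reindex_bij_witness[of _ "\<lambda>(v, w). v # w" "\<lambda>w. (hd w, tl w)"])
       (auto simp: closed_walks_def length_Suc_conv)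
  then show ?thesis
    by (simp add: sum.cartesian_product)
qed

text \<open>\<open>ks\<close> holds only the interior vertices of a path from \<open>i\<close> to
  \<open>j\<close>, so for \<open>i = j\<close> the closed walk is \<open>i # ks\<close>.\<close>

fun path_weight :: "('a \<Rightarrow> 'a \<Rightarrow> real) \<Rightarrow> 'a \<Rightarrow> 'a list \<Rightarrow> 'a \<Rightarrow> real" where
  "path_weight M i [] j = M i j"
| "path_weight M i (k # ks) j = M i k * path_weight M k ks j"

lemma path_weight_eq_prod:
  "path_weight M i ks j =
    (\<Prod>l<Suc (length ks). M ((i # ks @ [j]) ! l) ((i # ks @ [j]) ! Suc l))"
proof (induction ks arbitrary: i)
  case (Cons k ks)
  then show ?case
    by (simp add: prod.lessThan_Suc_shift del: prod.lessThan_Suc)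
qed simp

lemma funpow_mv_eq_sum:
  assumes "finite V"
  shows "(mv V M ^^ Suc n) x i = (\<Sum>ks\<in>closed_walks V n. \<Sum>j\<in>V. path_weight M i ks j * x j)"
proof (induction n arbitrary: i)
  case 0
  then show ?case by (simp add: mv_def closed_walks_0)
next
  case (Suc n)
  have "(mv V M ^^ Suc (Suc n)) x i = (\<Sum>k\<in>V. M i k * (mv V M ^^ Suc n) x k)"
    by (simp add: mv_def)
  also have "\<dots> = (\<Sum>k\<in>V. M i k * (\<Sum>ks\<in>closed_walks V n. \<Sum>j\<in>V. path_weight M k ks j * x j))"
    by (simp only: Suc)
  finally show ?case
    by (simp add: sum_closed_walks_Suc assms sum_distrib_left mult_ac)
qed

text \<open>Expanding the matrix product turns each diagonal entry into a sum over the paths that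
  return to their start.\<close>

lemma power_trace_eq_sum:
  assumes "finite V" and "0 < n"
  shows "power_trace V M n = (\<Sum>w\<in>closed_walks V n. \<Prod>l<n. M (w ! l) (w ! (Suc l mod n)))"
proof -
  obtain m where n: "n = Suc m" using \<open>0 < n\<close> by (cases n) auto
  have *: "path_weight M i ks i = (\<Prod>l<n. M ((i # ks) ! l) ((i # ks) ! (Suc l mod n)))"
    if "length ks = m" for i ks
    unfolding path_weight_eq_prod that n
  proof (intro prod.cong refl arg_cong2[of _ _ _ _ M])
    fix l assume "l \<in> {..<Suc m}"
    then show "(i # ks @ [i]) ! l = (i # ks) ! l"
      using that by (auto simp: nth_Cons nth_append split: nat.splits)
    show "(i # ks @ [i]) ! Suc l = (i # ks) ! (Suc l mod Suc m)"
      using that \<open>l \<in> _\<close> by (cases "l = m") (auto simp: nth_append)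
  qed
  have "power_trace V M n = (\<Sum>i\<in>V. \<Sum>ks\<in>closed_walks V m. \<Sum>j\<in>V. path_weight M i ks j * indicator {i} j)"
    unfolding power_trace_def n by (simp only: funpow_mv_eq_sum[OF assms(1)])
  also have "\<dots> = (\<Sum>i\<in>V. \<Sum>ks\<in>closed_walks V m. path_weight M i ks i)"
  proof (intro sum.cong refl)
    fix i ks assume "i \<in> V"
    then show "(\<Sum>j\<in>V. path_weight M i ks j * indicator {i} j) = path_weight M i ks i"
      using ip_indicator[of V i "path_weight M i ks"] assms(1) by (simp add: ip_def mult.commute)
  qed
  also have "\<dots> = (\<Sum>w\<in>closed_walks V n. \<Prod>l<n. M (w ! l) (w ! (Suc l mod n)))"
    unfolding n sum_closed_walks_Suc[OF assms(1)]
    using * by (intro sum.cong refl) (auto simp: closed_walks_def n)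
  finally show ?thesis .
qed

section \<open>Edges of closed walks and their multiplicities\<close>

definition walk_edge :: "'a list \<Rightarrow> nat \<Rightarrow> 'a set" where
  "walk_edge w i = {w ! i, w ! (Suc i mod length w)}"

definition walk_edges :: "'a list \<Rightarrow> 'a set set" where
  "walk_edges w = walk_edge w ` {..<length w}"

definition edge_mult :: "'a list \<Rightarrow> 'a set \<Rightarrow> nat" where
  "edge_mult w e = card {i\<in>{..<length w}. walk_edge w i = e}"

definition loopless :: "'a list \<Rightarrow> bool" where
  "loopless w \<longleftrightarrow> (\<forall>i<length w. w ! i \<noteq> w ! (Suc i mod length w))"

text \<open>The walks that survive in the expected trace: a loop meets a zero diagonal entry, and an
  edge used exactly once contributes a vanishing first moment.\<close>

definition good_walks :: "'a set \<Rightarrow> nat \<Rightarrow> 'a list set" where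
  "good_walks V n =
    {w\<in>closed_walks V n. loopless w \<and> (\<forall>e\<in>walk_edges w. 2 \<le> edge_mult w e)}"

lemma finite_good_walks: "finite V \<Longrightarrow> finite (good_walks V n)"
  unfolding good_walks_def by (simp add: finite_closed_walks)

lemma finite_walk_edges: "finite (walk_edges w)"
  by (simp add: walk_edges_def)

lemma card_walk_edges_le: "card (walk_edges w) \<le> length w"
  unfolding walk_edges_def using card_image_le[of "{..<length w}"] by simp

lemma walk_edge_subset: "i < length w \<Longrightarrow> walk_edge w i \<subseteq> set w"
proof -
  assume i: "i < length w"
  then have "Suc i mod length w < length w" by (intro mod_less_divisor) linarith
  with i show ?thesis by (auto simp: walk_edge_def)
qed

lemma walk_edge_map:
  assumes "i < length w"
  shows "walk_edge (map f w) i = f ` walk_edge w i"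
proof -
  have "Suc i mod length w < length w" using assms by (intro mod_less_divisor) linarith
  then show ?thesis using assms by (simp add: walk_edge_def)
qed

lemma prod_walk_edge:
  fixes F :: "'a set \<Rightarrow> real"
  shows "(\<Prod>i<length w. F (walk_edge w i)) = (\<Prod>e\<in>walk_edges w. F e ^ edge_mult w e)"
  unfolding walk_edges_def edge_mult_def
  by (subst prod.image_gen[of _ _ "walk_edge w"]) (auto intro!: prod.cong)

lemma edge_mult_pos: "e \<in> walk_edges w \<Longrightarrow> 0 < edge_mult w e"
  by (auto simp: walk_edges_def edge_mult_def card_gt_0_iff)

lemma edge_mult_eq_0: "e \<notin> walk_edges w \<Longrightarrow> edge_mult w e = 0"
  by (auto simp: walk_edges_def edge_mult_def)

lemma sum_edge_mult: "(\<Sum>e\<in>walk_edges w. edge_mult w e) = length w"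
  using sum.image_gen[of "{..<length w}" "\<lambda>_. 1::nat" "walk_edge w"]
  by (simp add: walk_edges_def edge_mult_def)

lemma card_walk_edges_good:
  assumes "w \<in> good_walks V n"
  shows "2 * card (walk_edges w) \<le> n"
proof -
  have "(\<Sum>e\<in>walk_edges w. 2) \<le> (\<Sum>e\<in>walk_edges w. edge_mult w e)"
    using assms by (intro sum_mono) (auto simp: good_walks_def)
  then show ?thesis
    using assms by (simp add: sum_edge_mult good_walks_def closed_walks_def)
qed

text \<open>A walk is connected: every vertex after the first is discovered through an edge that was
  not traversed before.\<close>

lemma card_set_le_walk_edges: "card (set w) \<le> Suc (card (walk_edges w))"
proof (cases "w = []")
  case False
  \<comment> \<open>Induction over initial segments, compared with the edges inside them; leaving
    out the closing edge keeps the indices from wrapping around.\<close>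
  have "card ((!) w ` {..k}) \<le> Suc (card (walk_edge w ` {..<k}))" if "k < length w" for k
    using that
  proof (induction k)
    case (Suc k)
    have *: "(!) w ` {..Suc k} = insert (w ! Suc k) ((!) w ` {..k})"
      by (simp add: atMost_Suc)
    have **: "walk_edge w ` {..<Suc k} = insert (walk_edge w k) (walk_edge w ` {..<k})"
      by (simp add: lessThan_Suc)
    show ?case
    proof (cases "w ! Suc k \<in> (!) w ` {..k}")
      case True
      have "card (walk_edge w ` {..<k}) \<le> card (walk_edge w ` {..<Suc k})"
        by (intro card_mono) auto
      with True Suc show ?thesis unfolding * by (simp add: insert_absorb)
    next
      case new: False
      \<comment> \<open>An earlier traversal of this edge would already have visited
        \<open>w ! Suc k\<close>.\<close>
      have "walk_edge w k \<notin> walk_edge w ` {..<k}"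
      proof
        assume "walk_edge w k \<in> walk_edge w ` {..<k}"
        then obtain l where "l < k" "walk_edge w k = walk_edge w l" by auto
        then have "w ! Suc k \<in> {w ! l, w ! Suc l}"
          using Suc.prems by (auto simp: walk_edge_def)
        then show False using new \<open>l < k\<close> by auto
      qed
      then show ?thesis unfolding * ** using new Suc by simp
    qed
  qed simp
  from this[of "length w - 1"] False
  have "card ((!) w ` {..length w - 1}) \<le> Suc (card (walk_edge w ` {..<length w - 1}))"
    by simp
  also have "(!) w ` {..length w - 1} = set w"
  proof -
    have "{..length w - 1} = {..<length w}"
      using False by (cases w) auto
    then show ?thesis by (auto simp: set_conv_nth)
  qed
  also have "card (walk_edge w ` {..<length w - 1}) \<le> card (walk_edges w)"
    unfolding walk_edges_def by (intro card_mono) auto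
  finally show ?thesis by simp
qed simp

text \<open>There are at most \<open>m\<close> edges since each is used twice. Equality means that
  the edges form a tree and each is traversed exactly twice.\<close>

lemma card_set_good:
  assumes "w \<in> good_walks V (2 * m)"
  shows "card (set w) \<le> Suc m"
  using card_walk_edges_good[OF assms] card_set_le_walk_edges[of w] by linarith

text \<open>Injectivity prevents new loops, and steps along the same edge stay along the same edge,
  so multiplicities do not drop.\<close>

lemma map_good_walks:
  assumes w: "w \<in> good_walks V n" and f: "inj_on f (set w)" "f ` set w \<subseteq> V'"
  shows "map f w \<in> good_walks V' n"
proof -
  have len: "length w = n" and ll: "loopless w" and e2: "\<And>e. e \<in> walk_edges w \<Longrightarrow> 2 \<le> edge_mult w e"
    using w by (auto simp: good_walks_def closed_walks_def)
  have "map f w \<in> closed_walks V' n"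
    using f len by (auto simp: closed_walks_def)
  moreover have "loopless (map f w)"
    unfolding loopless_def
  proof (intro allI impI)
    fix i assume "i < length (map f w)"
    then have i: "i < length w" and i': "Suc i mod length w < length w"
      by (auto intro!: mod_less_divisor)
    then have "w ! i \<noteq> w ! (Suc i mod length w)"
      using ll by (auto simp: loopless_def)
    then have "f (w ! i) \<noteq> f (w ! (Suc i mod length w))"
      using f(1) i i' by (meson inj_on_eq_iff nth_mem)
    then show "map f w ! i \<noteq> map f w ! (Suc i mod length (map f w))"
      using i i' by simp
  qed
  moreover have "2 \<le> edge_mult (map f w) e" if "e \<in> walk_edges (map f w)" for e
  proof -
    obtain i where i: "i < length w" "e = f ` walk_edge w i"
      using \<open>e \<in> _\<close> by (auto simp: walk_edges_def walk_edge_map)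
    have "{j\<in>{..<length w}. walk_edge w j = walk_edge w i} \<subseteq> {j\<in>{..<length (map f w)}. walk_edge (map f w) j = e}"
      using i by (auto simp: walk_edge_map)
    then have "edge_mult w (walk_edge w i) \<le> edge_mult (map f w) e"
      unfolding edge_mult_def by (intro card_mono) auto
    moreover have "2 \<le> edge_mult w (walk_edge w i)"
      using i by (intro e2) (auto simp: walk_edges_def)
    ultimately show ?thesis by linarith
  qed
  ultimately show ?thesis by (simp add: good_walks_def)
qed

section \<open>Walks up to relabelling of their vertices\<close>

definition same_shape :: "'a list \<Rightarrow> 'b list \<Rightarrow> bool" where
  "same_shape w w' \<longleftrightarrow> (\<exists>f. inj_on f (set w) \<and> w' = map f w)"

lemma same_shape_sym:
  assumes "same_shape w w'"
  shows "same_shape w' w"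
proof -
  obtain f where f: "inj_on f (set w)" "w' = map f w"
    using assms by (auto simp: same_shape_def)
  have "map (inv_into (set w) f) w' = w"
    unfolding f(2) map_map by (intro map_idI) (simp add: f(1))
  moreover have "inj_on (inv_into (set w) f) (set w')"
    unfolding f(2) using inj_on_inv_into[of "f ` set w" f "set w"] by simp
  ultimately show ?thesis unfolding same_shape_def by metis
qed

lemma same_shape_card: "same_shape w w' \<Longrightarrow> card (set w') = card (set w)"
  by (auto simp: same_shape_def card_image)

text \<open>A copy of \<open>w\<close> determines its relabelling on \<open>set w\<close>;
  extensional functions make this a bijection.\<close>

lemma card_same_shape:
  assumes "w \<in> good_walks V n"
  shows "card {w'\<in>good_walks V' n. same_shape w w'} = card {f \<in> set w \<rightarrow>\<^sub>E V'. inj_on f (set w)}"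
proof (rule sym, rule bij_betw_same_card)
  show "bij_betw (\<lambda>f. map f w) {f \<in> set w \<rightarrow>\<^sub>E V'. inj_on f (set w)}
    {w'\<in>good_walks V' n. same_shape w w'}"
    unfolding bij_betw_def
  proof (intro conjI equalityI subsetI)
    show "inj_on (\<lambda>f. map f w) {f \<in> set w \<rightarrow>\<^sub>E V'. inj_on f (set w)}"
      by (intro inj_onI) (auto intro: PiE_ext)
  next
    fix w' assume "w' \<in> (\<lambda>f. map f w) ` {f \<in> set w \<rightarrow>\<^sub>E V'. inj_on f (set w)}"
    then show "w' \<in> {w' \<in> good_walks V' n. same_shape w w'}"
      using map_good_walks[OF assms] by (auto simp: same_shape_def) 
  next
    fix w' assume "w' \<in> {w' \<in> good_walks V' n. same_shape w w'}"
    then obtain f where f: "inj_on f (set w)" "w' = map f w" "w' \<in> good_walks V' n"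
      by (auto simp: same_shape_def)
    then have "restrict f (set w) \<in> {f \<in> set w \<rightarrow>\<^sub>E V'. inj_on f (set w)}"
      by (auto simp: good_walks_def closed_walks_def inj_on_def)
    moreover have "w' = map (restrict f (set w)) w"
      using f by simp
    ultimately show "w' \<in> (\<lambda>f. map f w) ` {f \<in> set w \<rightarrow>\<^sub>E V'. inj_on f (set w)}"
      by blast
  qed
qed

text \<open>The injections are counted by a falling factorial, whose smallest factor is still at
  least \<open>m\<close> by the third hypothesis.\<close>

lemma card_injections_ge:
  assumes "finite A" "finite B" "card A + m \<le> Suc (card B)" "0 < m"
  shows "m ^ card A \<le> card {f \<in> A \<rightarrow>\<^sub>E B. inj_on f A}"
proof -
  have "m ^ card A = (\<Prod>i = 0..<card A. m)"
    by simp
  also have "\<dots> \<le> (\<Prod>i = 0..<card A. card B - i)"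
    using assms by (intro prod_mono) auto
  also have "\<dots> = card {f \<in> A \<rightarrow>\<^sub>E B. inj_on f A}"
    using assms by (simp add: card_inj_on_subset_funcset)
  finally show ?thesis .
qed

text \<open>Double counting of the pairs of walks of the same shape: a walk with \<open>v\<close> distinct vertices has
  at least \<open>m ^ v\<close> copies in \<open>V'\<close>, since \<open>v \<le> m + 1\<close>, and at most \<open>card V ^ v\<close> copies in \<open>V\<close>.\<close>

lemma good_walks_compare:
  fixes g :: "nat \<Rightarrow> real"
  assumes "finite V" "finite V'" "card V' = 2 * m" "0 < m" and g: "\<And>v. 0 \<le> g v"
  shows "(\<Sum>w\<in>good_walks V (2 * m). g (card (set w)))
    \<le> (\<Sum>w\<in>good_walks V' (2 * m). g (card (set w)) * (real (card V) / real m) ^ card (set w))"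
proof -
  let ?G = "good_walks V (2 * m)" and ?G' = "good_walks V' (2 * m)"
  \<comment> \<open>The weight \<open>g v\<close> of a walk in \<open>V\<close> is spread over its
    copies in \<open>V'\<close>. There are at least \<open>m ^ v\<close> of them, so shares of
    \<open>g v / m ^ v\<close> suffice.\<close>
  let ?h = "\<lambda>v. g v / real m ^ v"
  have "(\<Sum>w\<in>?G. g (card (set w))) \<le> (\<Sum>w\<in>?G. \<Sum>w'\<in>{w'\<in>?G'. same_shape w w'}. ?h (card (set w')))"
  proof (intro sum_mono)
    fix w assume w: "w \<in> ?G"
    let ?v = "card (set w)"
    have "m ^ ?v \<le> card {w'\<in>?G'. same_shape w w'}"
      unfolding card_same_shape[OF w] using card_set_good[OF w] assms
      by (intro card_injections_ge) auto
    then have "real m ^ ?v \<le> real (card {w'\<in>?G'. same_shape w w'})"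
      by (metis of_nat_le_iff of_nat_power)
    then have "real m ^ ?v * ?h ?v \<le> real (card {w'\<in>?G'. same_shape w w'}) * ?h ?v"
      using g by (intro mult_right_mono) auto
    also have "\<dots> = (\<Sum>w'\<in>{w'\<in>?G'. same_shape w w'}. ?h ?v)"
      by simp
    also have "\<dots> = (\<Sum>w'\<in>{w'\<in>?G'. same_shape w w'}. ?h (card (set w')))"
      by (intro sum.cong refl) (auto dest!: same_shape_card)
    finally show "g ?v \<le> (\<Sum>w'\<in>{w'\<in>?G'. same_shape w w'}. ?h (card (set w')))"
      using \<open>0 < m\<close> by simp
  qed
  also have "\<dots> = (\<Sum>w'\<in>?G'. \<Sum>w\<in>{w\<in>?G. same_shape w w'}. ?h (card (set w')))"
    using assms by (intro sum.swap_restrict) (auto simp: finite_good_walks)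
  also have "\<dots> \<le> (\<Sum>w'\<in>?G'. g (card (set w')) * (real (card V) / real m) ^ card (set w'))"
  proof (intro sum_mono)
    fix w' assume w': "w' \<in> ?G'"
    let ?v = "card (set w')"
    have "card {w\<in>?G. same_shape w w'} = card {w\<in>?G. same_shape w' w}"
      by (metis same_shape_sym)
    also have "\<dots> = card {f \<in> set w' \<rightarrow>\<^sub>E V. inj_on f (set w')}"
      by (rule card_same_shape[OF w'])
    also have "\<dots> \<le> card (set w' \<rightarrow>\<^sub>E V)"
      using assms by (intro card_mono finite_PiE) auto
    also have "\<dots> = card V ^ ?v"
      by (simp add: card_PiE)
    finally have "real (card {w\<in>?G. same_shape w w'}) \<le> real (card V) ^ ?v"
      by (metis of_nat_le_iff of_nat_power)
    then have "real (card {w\<in>?G. same_shape w w'}) * ?h ?v \<le> real (card V) ^ ?v * ?h ?v"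
      using g by (intro mult_right_mono) auto
    then show "(\<Sum>w\<in>{w\<in>?G. same_shape w w'}. ?h ?v) \<le> g ?v * (real (card V) / real m) ^ ?v"
      by (simp add: power_divide mult.commute)
  qed
  finally show ?thesis .
qed

subsection \<open>Averaging over skew random signs\<close>

definition vertex_pairs :: "'a set \<Rightarrow> 'a set set" where
  "vertex_pairs V = {e. e \<subseteq> V \<and> card e = 2}"

text \<open>Entries are indexed by unordered pairs, so that the matrix is symmetric by construction
  and each edge is a single independent variable.\<close>

definition edge_matrix :: "('a set \<Rightarrow> real) \<Rightarrow> 'a \<Rightarrow> 'a \<Rightarrow> real" where
  "edge_matrix F u v = (if u = v then 0 else F {u, v})"

lemma edge_matrix_sym: "edge_matrix F u v = edge_matrix F v u"
  by (simp add: edge_matrix_def insert_commute)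

lemma finite_vertex_pairs: "finite V \<Longrightarrow> finite (vertex_pairs V)"
  unfolding vertex_pairs_def by (rule finite_subset[of _ "Pow V"]) auto

lemma walk_edges_loopless:
  assumes "w \<in> closed_walks V n" "loopless w"
  shows "walk_edges w \<subseteq> vertex_pairs V"
proof
  fix e assume "e \<in> walk_edges w"
  then obtain i where i: "i < length w" "e = walk_edge w i"
    by (auto simp: walk_edges_def)
  have "e \<subseteq> V"
    using walk_edge_subset[OF i(1)] assms(1) i(2) by (auto simp: closed_walks_def)
  moreover have "card e = 2"
    using assms(2) i by (auto simp: loopless_def walk_edge_def)
  ultimately show "e \<in> vertex_pairs V" by (simp add: vertex_pairs_def)
qed

text \<open>The zero diagonal removes walks with loops; in the others the factors are grouped by
  edge, ready for independence.\<close>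

lemma power_trace_edge_matrix:
  assumes "finite V" "0 < n"
  shows "power_trace V (edge_matrix F) n =
    (\<Sum>w\<in>{w\<in>closed_walks V n. loopless w}. \<Prod>e\<in>walk_edges w. F e ^ edge_mult w e)"
proof -
  have "power_trace V (edge_matrix F) n =
    (\<Sum>w\<in>closed_walks V n. if loopless w then \<Prod>e\<in>walk_edges w. F e ^ edge_mult w e else 0)"
    unfolding power_trace_eq_sum[OF assms]
  proof (intro sum.cong refl)
    fix w assume "w \<in> closed_walks V n"
    then have n: "n = length w" by (simp add: closed_walks_def)
    show "(\<Prod>l<n. edge_matrix F (w ! l) (w ! (Suc l mod n))) =
      (if loopless w then \<Prod>e\<in>walk_edges w. F e ^ edge_mult w e else 0)"
    proof (cases "loopless w")
      case True
      then have "(\<Prod>l<n. edge_matrix F (w ! l) (w ! (Suc l mod n))) = (\<Prod>l<length w. F (walk_edge w l))"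
        unfolding n by (intro prod.cong) (auto simp: edge_matrix_def loopless_def walk_edge_def)
      with True show ?thesis by (simp add: prod_walk_edge)
    next
      case False
      then obtain l where "l < n" "w ! l = w ! (Suc l mod n)"
        unfolding n by (auto simp: loopless_def)
      then have "\<exists>l\<in>{..<n}. edge_matrix F (w ! l) (w ! (Suc l mod n)) = 0"
        by (auto simp: edge_matrix_def)
      with False show ?thesis by (simp add: prod_zero)
    qed
  qed
  then show ?thesis
    using assms by (simp add: sum.inter_filter finite_closed_walks)
qed

text \<open>The coefficient of the entry \<open>F e\<close> in the bilinear form of
  \<open>edge_matrix F\<close>: for distinct \<open>u\<close>, \<open>v\<close> in \<open>V\<close>
  and \<open>e = {u, v}\<close> it is \<open>x u * y v + x v * y u\<close>.\<close>

definition pair_coeff :: "'a set \<Rightarrow> ('a \<Rightarrow> real) \<Rightarrow> ('a \<Rightarrow> real) \<Rightarrow> 'a set \<Rightarrow> real" where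
  "pair_coeff V x y e = (\<Sum>(i, j)\<in>{(i, j)\<in>V \<times> V. {i, j} = e}. x i * y j)"

lemma sum_vertex_pairs:
  fixes h :: "'a \<times> 'a \<Rightarrow> real"
  assumes "finite V"
  shows "(\<Sum>e\<in>vertex_pairs V. \<Sum>q\<in>{(i, j)\<in>V \<times> V. {i, j} = e}. h q) =
    (\<Sum>q\<in>{(i, j)\<in>V \<times> V. i \<noteq> j}. h q)"
proof -
  let ?D = "{(i, j)\<in>V \<times> V. i \<noteq> j}"
  have fin: "finite ?D"
    using assms by (rule_tac finite_subset[of _ "V \<times> V"]) auto
  have "(\<Sum>q\<in>?D. h q) = (\<Sum>e\<in>vertex_pairs V. \<Sum>q\<in>{q\<in>?D. (\<lambda>(i, j). {i, j}) q = e}. h q)"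
    using fin assms
    by (intro sum.group[symmetric]) (auto simp: vertex_pairs_def finite_vertex_pairs[unfolded vertex_pairs_def])
  also have "\<dots> = (\<Sum>e\<in>vertex_pairs V. \<Sum>q\<in>{(i, j)\<in>V \<times> V. {i, j} = e}. h q)"
    by (intro sum.cong refl) (auto simp: vertex_pairs_def)
  finally show ?thesis by simp
qed

lemma bilinear_edge_matrix:
  assumes "finite V"
  shows "ip V x (mv V (edge_matrix F) y) = (\<Sum>e\<in>vertex_pairs V. F e * pair_coeff V x y e)"
proof -
  have "ip V x (mv V (edge_matrix F) y) = (\<Sum>(i, j)\<in>V \<times> V. edge_matrix F i j * (x i * y j))"
    by (simp add: ip_def mv_def sum_distrib_left sum.cartesian_product mult_ac)
  also have "\<dots> = (\<Sum>(i, j)\<in>{(i, j)\<in>V \<times> V. i \<noteq> j}. edge_matrix F i j * (x i * y j))"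
    using assms by (intro sum.mono_neutral_right) (auto simp: edge_matrix_def)
  also have "\<dots> = (\<Sum>(i, j)\<in>{(i, j)\<in>V \<times> V. i \<noteq> j}. F {i, j} * (x i * y j))"
    by (intro sum.cong) (auto simp: edge_matrix_def)
  also have "\<dots> = (\<Sum>e\<in>vertex_pairs V. \<Sum>(i, j)\<in>{(i, j)\<in>V \<times> V. {i, j} = e}. F {i, j} * (x i * y j))"
    by (rule sum_vertex_pairs[OF assms, symmetric])
  also have "\<dots> = (\<Sum>e\<in>vertex_pairs V. F e * pair_coeff V x y e)"
    unfolding pair_coeff_def sum_distrib_left by (intro sum.cong) auto
  finally show ?thesis .
qed

text \<open>A pair has at most two orientations, so squaring its coefficient costs a factor 2. This
  sum plays the part of the variance in the exponential moment bound.\<close>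

lemma sum_pair_coeff_squared:
  assumes "finite V"
  shows "(\<Sum>e\<in>vertex_pairs V. (pair_coeff V x y e)\<^sup>2) \<le> 2 * ip V x x * ip V y y"
proof -
  have "(\<Sum>e\<in>vertex_pairs V. (pair_coeff V x y e)\<^sup>2)
    \<le> (\<Sum>e\<in>vertex_pairs V. \<Sum>q\<in>{(i, j)\<in>V \<times> V. {i, j} = e}. 2 * (case q of (i, j) \<Rightarrow> (x i * y j)\<^sup>2))"
  proof (intro sum_mono)
    fix e assume "e \<in> vertex_pairs V"
    then obtain u v where e: "e = {u, v}" by (auto simp: vertex_pairs_def card_2_iff)
    let ?Q = "{(i, j)\<in>V \<times> V. {i, j} = e}"
    have "card ?Q \<le> card {(u, v), (v, u)}"
      unfolding e by (intro card_mono) (auto simp: doubleton_eq_iff)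
    also have "\<dots> \<le> 2" using card_length[of "[(u, v), (v, u)]"] by simp
    finally have "real (card ?Q) \<le> 2" by simp
    have "(pair_coeff V x y e)\<^sup>2 \<le> (\<Sum>q\<in>?Q. (case q of (i, j) \<Rightarrow> x i * y j)\<^sup>2) * real (card ?Q)"
      unfolding pair_coeff_def by (rule sum_squared_le_sum_of_squares)
    also have "\<dots> \<le> (\<Sum>q\<in>?Q. (case q of (i, j) \<Rightarrow> x i * y j)\<^sup>2) * 2"
      using \<open>real (card ?Q) \<le> 2\<close> by (intro mult_left_mono sum_nonneg) auto
    also have "\<dots> = (\<Sum>q\<in>?Q. 2 * (case q of (i, j) \<Rightarrow> (x i * y j)\<^sup>2))"
      unfolding sum_distrib_right by (intro sum.cong) auto
    finally show "(pair_coeff V x y e)\<^sup>2 \<le> (\<Sum>q\<in>?Q. 2 * (case q of (i, j) \<Rightarrow> (x i * y j)\<^sup>2))" .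
  qed
  also have "\<dots> = (\<Sum>q\<in>{(i, j)\<in>V \<times> V. i \<noteq> j}. 2 * (case q of (i, j) \<Rightarrow> (x i * y j)\<^sup>2))"
    by (rule sum_vertex_pairs[OF assms])
  also have "\<dots> \<le> (\<Sum>q\<in>V \<times> V. 2 * (case q of (i, j) \<Rightarrow> (x i * y j)\<^sup>2))"
    using assms by (intro sum_mono2) auto
  also have "\<dots> = 2 * (\<Sum>i\<in>V. \<Sum>j\<in>V. (x i)\<^sup>2 * (y j)\<^sup>2)"
    by (simp add: sum.cartesian_product sum_distrib_left power_mult_distrib case_prod_beta)
  also have "\<dots> = 2 * ip V x x * ip V y y"
    unfolding ip_def by (simp add: sum_product power2_eq_square mult_ac)
  finally show ?thesis .
qed

text \<open>The average over independent entries that are \<open>2\<close> with probability \<open>1/3\<close> and \<open>-1\<close> with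
  probability \<open>2/3\<close>: the first moment vanishes, and all higher moments, odd ones included, are at
  least \<open>1\<close>. So the expected trace of a power bounds the number of good walks.\<close>

definition skew_weight :: "real \<Rightarrow> real" where
  "skew_weight y = (if y = 2 then 1 / 3 else 2 / 3)"

definition skew_avg :: "'e set \<Rightarrow> (('e \<Rightarrow> real) \<Rightarrow> real) \<Rightarrow> real" where
  "skew_avg P \<Phi> = (\<Sum>f\<in>P \<rightarrow>\<^sub>E {-1, 2}. (\<Prod>e\<in>P. skew_weight (f e)) * \<Phi> f)"

lemma skew_avg_mono:
  "(\<And>f. f \<in> P \<rightarrow>\<^sub>E {-1, 2} \<Longrightarrow> \<Phi> f \<le> \<Psi> f) \<Longrightarrow> skew_avg P \<Phi> \<le> skew_avg P \<Psi>"
  unfolding skew_avg_def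
  by (intro sum_mono mult_left_mono prod_nonneg) (auto simp: skew_weight_def)

lemma skew_avg_sum: "skew_avg P (\<lambda>f. \<Sum>i\<in>I. \<Phi> i f) = (\<Sum>i\<in>I. skew_avg P (\<Phi> i))"
  unfolding skew_avg_def sum_distrib_left by (rule sum.swap)

lemma skew_avg_add: "skew_avg P (\<lambda>f. \<Phi> f + \<Psi> f) = skew_avg P \<Phi> + skew_avg P \<Psi>"
  unfolding skew_avg_def by (simp add: distrib_left sum.distrib)

lemma skew_avg_cmult: "skew_avg P (\<lambda>f. c * \<Phi> f) = c * skew_avg P \<Phi>"
  unfolding skew_avg_def by (simp add: sum_distrib_left mult_ac)

text \<open>Independence of the entries, which for a finite average is distributivity of products
  over sums.\<close>

lemma skew_avg_prod:
  assumes "finite P"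
  shows "skew_avg P (\<lambda>f. \<Prod>e\<in>P. g e (f e)) = (\<Prod>e\<in>P. (g e 2 + 2 * g e (-1)) / 3)"
proof -
  have "skew_avg P (\<lambda>f. \<Prod>e\<in>P. g e (f e)) = (\<Sum>f\<in>P \<rightarrow>\<^sub>E {-1, 2}. \<Prod>e\<in>P. skew_weight (f e) * g e (f e))"
    unfolding skew_avg_def by (simp add: prod.distrib)
  also have "\<dots> = (\<Prod>e\<in>P. \<Sum>y\<in>{-1, 2}. skew_weight y * g e y)"
    using assms by (intro prod_sum_PiE[symmetric]) auto
  also have "\<dots> = (\<Prod>e\<in>P. (g e 2 + 2 * g e (-1)) / 3)"
    by (intro prod.cong refl) (simp add: skew_weight_def field_simps)
  finally show ?thesis .
qed

text \<open>From \<open>j = 3\<close> on, \<open>2 ^ j\<close> is at least 8, which outweighs the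
  loss of at most 2 from an odd power of -1.\<close>

lemma skew_moment_ge_1:
  assumes "j \<noteq> 1"
  shows "1 \<le> ((2::real) ^ j + 2 * (-1) ^ j) / 3"
proof (cases "j < 3")
  case True
  then have "j = 0 \<or> j = 2" using assms by linarith
  then show ?thesis by auto
next
  case False
  then have "(2::real) ^ 3 \<le> 2 ^ j" by (intro power_increasing) auto
  moreover have "(-1::real) \<le> (-1) ^ j" by (cases "even j") auto
  ultimately show ?thesis by (simp add: field_simps)
qed

text \<open>By independence every loopless walk contributes a product of moments. Good walks
  contribute at least 1, and no walk contributes a negative amount.\<close>

lemma card_good_walks_le_skew_avg:
  assumes "finite V" "0 < n"
  shows "real (card (good_walks V n))
    \<le> skew_avg (vertex_pairs V) (\<lambda>f. power_trace V (edge_matrix f) n)"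
proof -
  let ?P = "vertex_pairs V" and ?L = "{w\<in>closed_walks V n. loopless w}"
  define \<mu> where "\<mu> w = (\<Prod>e\<in>?P. ((2::real) ^ edge_mult w e + 2 * (-1) ^ edge_mult w e) / 3)" for w
  have *: "skew_avg ?P (\<lambda>f. \<Prod>e\<in>walk_edges w. f e ^ edge_mult w e) = \<mu> w" if "w \<in> ?L" for w
  proof -
    have "(\<Prod>e\<in>walk_edges w. f e ^ edge_mult w e) = (\<Prod>e\<in>?P. f e ^ edge_mult w e)" for f :: "'a set \<Rightarrow> real"
      using walk_edges_loopless[of w V n] that assms(1)
      by (intro prod.mono_neutral_left) (auto simp: finite_vertex_pairs edge_mult_eq_0)
    then show ?thesis
      unfolding \<mu>_def
      using skew_avg_prod[OF finite_vertex_pairs[OF assms(1)], of "\<lambda>e y. y ^ edge_mult w e"] by simp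
  qed
  have good: "1 \<le> \<mu> w" if "w \<in> good_walks V n" for w
    unfolding \<mu>_def
  proof (intro prod_ge_1)
    fix e
    have "edge_mult w e \<noteq> 1"
      using that edge_mult_eq_0[of e w] by (cases "e \<in> walk_edges w") (force simp: good_walks_def)+
    then show "1 \<le> ((2::real) ^ edge_mult w e + 2 * (-1) ^ edge_mult w e) / 3"
      by (rule skew_moment_ge_1)
  qed
  have nonneg: "0 \<le> \<mu> w" for w
    unfolding \<mu>_def
  proof (intro prod_nonneg)
    fix e
    show "0 \<le> ((2::real) ^ edge_mult w e + 2 * (-1) ^ edge_mult w e) / 3"
      using skew_moment_ge_1[of "edge_mult w e"] by (cases "edge_mult w e = 1") auto
  qed
  have "real (card (good_walks V n)) = (\<Sum>w\<in>good_walks V n. 1)"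
    by simp
  also have "\<dots> \<le> (\<Sum>w\<in>good_walks V n. \<mu> w)"
    using good by (rule sum_mono)
  also have "\<dots> \<le> (\<Sum>w\<in>?L. \<mu> w)"
    using nonneg assms(1) by (intro sum_mono2) (auto simp: finite_closed_walks good_walks_def)
  also have "\<dots> = (\<Sum>w\<in>?L. skew_avg ?P (\<lambda>f. \<Prod>e\<in>walk_edges w. f e ^ edge_mult w e))"
    by (intro sum.cong refl *[symmetric])
  also have "\<dots> = skew_avg ?P (\<lambda>f. power_trace V (edge_matrix f) n)"
    unfolding power_trace_edge_matrix[OF assms] by (rule skew_avg_sum[symmetric])
  finally show ?thesis .
qed

text \<open>The linear term cancels when averaged over a centered variable, which leaves a
  subgaussian bound.\<close>

lemma exp_le_add_exp_square: "exp (x::real) \<le> x + exp (x\<^sup>2)"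
proof (cases "1 < x")
  case True
  then have "x * 1 \<le> x * x" by (intro mult_left_mono) auto
  then show ?thesis using True by (simp add: power2_eq_square add_increasing)
next
  case False
  have "exp x \<le> 1 + x + x\<^sup>2"
  proof (cases "0 \<le> x")
    case True
    then show ?thesis using False by (intro exp_bound) auto
  next
    case neg: False
    have "(1 - x) * (1 + x + x\<^sup>2) = 1 + (- x) * x\<^sup>2" by algebra
    moreover have "0 \<le> (- x) * x\<^sup>2" using neg by (intro mult_nonneg_nonneg) auto
    ultimately have "1 \<le> (1 - x) * (1 + x + x\<^sup>2)" by linarith
    also have "\<dots> \<le> exp (- x) * (1 + x + x\<^sup>2)"
    proof (rule mult_right_mono)
      show "1 - x \<le> exp (- x)" using exp_ge_add_one_self[of "- x"] by simp
      have "0 \<le> (1 + 2 * x)\<^sup>2 + 3" by simp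
      then show "0 \<le> 1 + x + x\<^sup>2" by (simp add: power2_eq_square algebra_simps)
    qed
    finally have "exp x * 1 \<le> exp x * (exp (- x) * (1 + x + x\<^sup>2))"
      by (intro mult_left_mono) auto
    also have "\<dots> = (exp x * exp (- x)) * (1 + x + x\<^sup>2)"
      by (rule mult.assoc[symmetric])
    finally show ?thesis by (simp add: exp_minus_inverse)
  qed
  also have "\<dots> \<le> x + exp (x\<^sup>2)" by simp
  finally show ?thesis .
qed

lemma skew_avg_exp:
  assumes "finite P"
  shows "skew_avg P (\<lambda>f. exp (\<Sum>e\<in>P. f e * a e)) \<le> exp (4 * (\<Sum>e\<in>P. (a e)\<^sup>2))"
proof -
  \<comment> \<open>The linear terms \<open>2 * t\<close> and \<open>2 * (- t)\<close> cancel; the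
    factor 4 is the square of the largest value 2.\<close>
  have *: "(exp (2 * t) + 2 * exp (- t)) / 3 \<le> exp (4 * t\<^sup>2)" for t :: real
  proof -
    have "exp (2 * t) \<le> 2 * t + exp (4 * t\<^sup>2)"
      using exp_le_add_exp_square[of "2 * t"] by (simp add: power_mult_distrib)
    moreover have "exp (- t) \<le> - t + exp (4 * t\<^sup>2)"
      using exp_le_add_exp_square[of "- t"] by (rule order.trans) simp
    ultimately show ?thesis by (simp add: field_simps)
  qed
  have "skew_avg P (\<lambda>f. exp (\<Sum>e\<in>P. f e * a e)) = (\<Prod>e\<in>P. (exp (2 * a e) + 2 * exp (- a e)) / 3)"
    using skew_avg_prod[OF assms, of "\<lambda>e y. exp (y * a e)"] assms by (simp add: exp_sum)
  also have "\<dots> \<le> (\<Prod>e\<in>P. exp (4 * (a e)\<^sup>2))"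
    using * by (intro prod_mono) (auto intro: add_nonneg_nonneg)
  also have "\<dots> = exp (4 * (\<Sum>e\<in>P. (a e)\<^sup>2))"
    using assms by (simp add: exp_sum sum_distrib_left)
  finally show ?thesis .
qed

text \<open>One term of the exponential series at \<open>\<bar>x\<bar>\<close> is at most the whole
  series.\<close>

lemma even_power_le_fact_exp: "(x::real) ^ (2 * m) \<le> fact (2 * m) * (exp x + exp (- x))"
proof -
  have *: "y ^ n \<le> fact n * exp y" if "0 \<le> y" for y :: real and n
  proof -
    have "(\<Sum>k\<in>{n}. y ^ k /\<^sub>R fact k) \<le> (\<Sum>k. y ^ k /\<^sub>R fact k)"
      using exp_converges[of y] that by (intro sum_le_suminf) (auto simp: sums_iff)
    also have "\<dots> = exp y"
      using exp_converges[of y] by (simp add: sums_iff)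
    finally show ?thesis by (simp add: field_simps)
  qed
  have "x ^ (2 * m) = \<bar>x\<bar> ^ (2 * m)" by (simp add: power_mult)
  also have "\<dots> \<le> fact (2 * m) * exp \<bar>x\<bar>" by (intro *) simp
  also have "\<dots> \<le> fact (2 * m) * (exp x + exp (- x))"
    by (intro mult_left_mono) (auto simp: abs_if)
  finally show ?thesis .
qed

text \<open>The exponential moment method with a free scale \<open>t\<close>; both signs of
  \<open>t\<close> enter because the even power is controlled through
  \<open>\<bar>x\<bar>\<close>.\<close>

lemma skew_avg_even_power:
  assumes "finite P" "0 < t"
  shows "skew_avg P (\<lambda>f. (\<Sum>e\<in>P. f e * a e) ^ (2 * m))
    \<le> 2 * fact (2 * m) / t ^ (2 * m) * exp (4 * t\<^sup>2 * (\<Sum>e\<in>P. (a e)\<^sup>2))"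
proof -
  have *: "skew_avg P (\<lambda>f. exp (\<Sum>e\<in>P. f e * (c * a e))) \<le> exp (4 * c\<^sup>2 * (\<Sum>e\<in>P. (a e)\<^sup>2))" for c
  proof -
    have "(\<Sum>e\<in>P. (c * a e)\<^sup>2) = c\<^sup>2 * (\<Sum>e\<in>P. (a e)\<^sup>2)"
      by (simp add: power_mult_distrib sum_distrib_left)
    then show ?thesis
      using skew_avg_exp[OF assms(1), of "\<lambda>e. c * a e"] by (simp add: mult.assoc)
  qed
  let ?X = "\<lambda>f. exp (\<Sum>e\<in>P. f e * (t * a e)) + exp (\<Sum>e\<in>P. f e * (- t * a e))"
  have "skew_avg P (\<lambda>f. (\<Sum>e\<in>P. f e * a e) ^ (2 * m))
    \<le> skew_avg P (\<lambda>f. (fact (2 * m) / t ^ (2 * m)) * ?X f)"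
  proof (rule skew_avg_mono)
    fix f :: "'a \<Rightarrow> real"
    have "(t * (\<Sum>e\<in>P. f e * a e)) ^ (2 * m) \<le> fact (2 * m) * ?X f"
      using even_power_le_fact_exp[of "t * (\<Sum>e\<in>P. f e * a e)" m]
      by (simp add: sum_distrib_left sum_negf mult.left_commute)
    then have "(t * (\<Sum>e\<in>P. f e * a e)) ^ (2 * m) / t ^ (2 * m) \<le> fact (2 * m) * ?X f / t ^ (2 * m)"
      by (rule divide_right_mono) (use assms(2) in simp)
    moreover have "(t * (\<Sum>e\<in>P. f e * a e)) ^ (2 * m) / t ^ (2 * m) = (\<Sum>e\<in>P. f e * a e) ^ (2 * m)"
      unfolding power_mult_distrib using assms(2) by simp
    ultimately show "(\<Sum>e\<in>P. f e * a e) ^ (2 * m) \<le> (fact (2 * m) / t ^ (2 * m)) * ?X f"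
      unfolding times_divide_eq_left by (simp only:)
  qed
  also have "\<dots> = (fact (2 * m) / t ^ (2 * m)) *
      (skew_avg P (\<lambda>f. exp (\<Sum>e\<in>P. f e * (t * a e))) + skew_avg P (\<lambda>f. exp (\<Sum>e\<in>P. f e * (- t * a e))))"
    unfolding skew_avg_cmult[of P "fact (2 * m) / t ^ (2 * m)" ?X] skew_avg_add ..
  also have "\<dots> \<le> (fact (2 * m) / t ^ (2 * m)) *
      (exp (4 * t\<^sup>2 * (\<Sum>e\<in>P. (a e)\<^sup>2)) + exp (4 * t\<^sup>2 * (\<Sum>e\<in>P. (a e)\<^sup>2)))"
    using assms(2) *[of t] *[of "- t", unfolded power2_minus]
    by (intro mult_left_mono add_mono) simp_all
  finally show ?thesis by (simp add: mult_ac)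
qed

subsection \<open>Counting good walks on few vertices\<close>

text \<open>This integer version of an \<open>\<epsilon>\<close>-net turns the operator norm into a maximum over exponentially
  many bilinear forms: rounding \<open>2 * sqrt (card V)\<close> times a unit vector towards zero lands in it.\<close>

definition norming_set :: "'a set \<Rightarrow> ('a \<Rightarrow> real) set" where
  "norming_set V = {z \<in> V \<rightarrow>\<^sub>E of_int ` {- 4 * int (card V)..4 * int (card V)}. ip V z z \<le> 4 * real (card V)}"

lemma finite_norming_set: "finite V \<Longrightarrow> finite (norming_set V)"
  unfolding norming_set_def by (simp add: finite_PiE)

lemma norming_set_nonempty: "norming_set V \<noteq> {}"
proof -
  have "(\<lambda>i\<in>V. 0) \<in> norming_set V"
    by (auto simp: norming_set_def ip_def intro!: image_eqI[of _ _ "0::int"])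
  then show ?thesis by blast
qed

text \<open>Let \<open>w\<close> be scaled to length \<open>2 * sqrt r\<close> and rounded towards
  zero. Before rounding its inner product with \<open>w\<close> is \<open>2 * sqrt r * N\<close>;
  rounding costs at most the 1-norm of \<open>w\<close>, hence at most \<open>sqrt r * N\<close>, so
  half of it survives.\<close>

lemma norming_set_norming:
  assumes fin: "finite V" and "V \<noteq> {}"
  shows "\<exists>z\<in>norming_set V. real (card V) * ip V w w \<le> (ip V z w)\<^sup>2"
proof (cases "ip V w w = 0")
  case True
  then show ?thesis using norming_set_nonempty[of V] by auto
next
  case False
  define r where "r = real (card V)"
  define N where "N = sqrt (ip V w w)"
  have N2: "N\<^sup>2 = ip V w w" and "0 < N"
    using False ip_self_nonneg[of V w] by (auto simp: N_def)
  have "1 \<le> card V" using assms by (simp add: Suc_le_eq card_gt_0_iff)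
  then have "1 \<le> r" by (simp add: r_def)
  define a where "a i = 2 * sqrt r * \<bar>w i\<bar> / N" for i
  define z where "z = (\<lambda>i\<in>V. real_of_int (if 0 \<le> w i then \<lfloor>a i\<rfloor> else - \<lfloor>a i\<rfloor>))"
  have a_nonneg: "0 \<le> a i" for i
    using \<open>0 < N\<close> by (simp add: a_def r_def)
  have z_sq: "(z i)\<^sup>2 = (real_of_int \<lfloor>a i\<rfloor>)\<^sup>2" if "i \<in> V" for i
    using that by (simp add: z_def)
  have z_le: "(z i)\<^sup>2 \<le> 4 * r * (w i)\<^sup>2 / N\<^sup>2" if "i \<in> V" for i
  proof -
    have "(z i)\<^sup>2 \<le> (a i)\<^sup>2"
      unfolding z_sq[OF that] using a_nonneg[of i] by (intro power_mono) auto
    then show ?thesis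
      by (simp add: a_def power_divide power_mult_distrib r_def)
  qed
  have "ip V z z = (\<Sum>i\<in>V. (z i)\<^sup>2)"
    by (simp add: ip_def power2_eq_square)
  also have "\<dots> \<le> (\<Sum>i\<in>V. 4 * r * (w i)\<^sup>2 / N\<^sup>2)"
    using z_le by (rule sum_mono)
  also have "\<dots> = 4 * r / N\<^sup>2 * ip V w w"
    by (simp add: ip_def power2_eq_square sum_distrib_left)
  finally have zz: "ip V z z \<le> 4 * r"
    using N2 False by simp
  have "z i \<in> of_int ` {- 4 * int (card V)..4 * int (card V)}" if "i \<in> V" for i
  proof -
    define k where "k = (if 0 \<le> w i then \<lfloor>a i\<rfloor> else - \<lfloor>a i\<rfloor>)"
    have zk: "z i = of_int k" using that by (simp add: z_def k_def)
    have "(z i)\<^sup>2 \<le> (\<Sum>i\<in>V. (z i)\<^sup>2)"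
      using that fin by (intro member_le_sum) auto
    also have "\<dots> \<le> 4 * r" using zz by (simp add: ip_def power2_eq_square)
    finally have "of_int (k\<^sup>2) \<le> (of_int (4 * int (card V)) :: real)"
      by (simp add: zk r_def)
    then have "k\<^sup>2 \<le> 4 * int (card V)" by (simp only: of_int_le_iff)
    \<comment> \<open>An integer is at most its square in absolute value, so the norm bound places
      each coordinate in the finite box.\<close>
    moreover have "\<bar>k\<bar> \<le> k\<^sup>2"
    proof (cases "k = 0")
      case False
      then have "\<bar>k\<bar> * 1 \<le> \<bar>k\<bar> * \<bar>k\<bar>" by (intro mult_left_mono) auto
      then show ?thesis by (simp add: power2_eq_square abs_mult[symmetric])
    qed simp
    ultimately have "k \<in> {- 4 * int (card V)..4 * int (card V)}" by auto
    then show ?thesis unfolding zk by (rule imageI)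
  qed
  then have mem: "z \<in> norming_set V"
    using zz by (auto simp: norming_set_def r_def z_def)
  have "(\<Sum>i\<in>V. \<bar>w i\<bar>)\<^sup>2 \<le> (\<Sum>i\<in>V. \<bar>w i\<bar>\<^sup>2) * r"
    unfolding r_def by (rule sum_squared_le_sum_of_squares)
  also have "\<dots> = (sqrt r * N)\<^sup>2"
    using \<open>1 \<le> r\<close> by (simp add: power_mult_distrib N2 ip_def power2_eq_square[of "w _"])
  finally have l1: "(\<Sum>i\<in>V. \<bar>w i\<bar>) \<le> sqrt r * N"
    by (rule power2_le_imp_le) (use \<open>1 \<le> r\<close> \<open>0 < N\<close> in auto)
  have "2 * sqrt r * N - sqrt r * N \<le> 2 * sqrt r / N * ip V w w - (\<Sum>i\<in>V. \<bar>w i\<bar>)"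
    using l1 \<open>0 < N\<close> by (simp add: N2[symmetric] power2_eq_square mult.commute)
  also have "\<dots> = (\<Sum>i\<in>V. (a i - 1) * \<bar>w i\<bar>)"
    by (simp add: a_def ip_def left_diff_distrib sum_subtractf sum_distrib_left mult.assoc)
  also have "\<dots> \<le> (\<Sum>i\<in>V. z i * w i)"
  proof (rule sum_mono)
    fix i assume "i \<in> V"
    then have "z i * w i = real_of_int \<lfloor>a i\<rfloor> * \<bar>w i\<bar>"
      by (simp add: z_def)
    moreover have "(a i - 1) * \<bar>w i\<bar> \<le> real_of_int \<lfloor>a i\<rfloor> * \<bar>w i\<bar>"
      by (intro mult_right_mono) linarith+
    ultimately show "(a i - 1) * \<bar>w i\<bar> \<le> z i * w i" by simp
  qed
  finally have "sqrt r * N \<le> ip V z w"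
    by (simp add: ip_def mult.commute)
  then have "(sqrt r * N)\<^sup>2 \<le> (ip V z w)\<^sup>2"
    using \<open>1 \<le> r\<close> \<open>0 < N\<close> by (intro power_mono) auto
  then have "r * ip V w w \<le> (ip V z w)\<^sup>2"
    using \<open>1 \<le> r\<close> by (simp add: power_mult_distrib N2)
  then show ?thesis using mem by (auto simp: r_def)
qed

lemma sum_half_powers_le_3: "(\<Sum>j\<in>{- int K..int K}. (1 / 2 :: real) ^ nat \<bar>j\<bar>) \<le> 3"
proof -
  have "(\<Sum>j\<in>{- int K..int K}. (1 / 2 :: real) ^ nat \<bar>j\<bar>) = 3 - 2 * (1 / 2) ^ K"
  proof (induction K)
    case (Suc K)
    have "{- int (Suc K)..int (Suc K)} = insert (- int (Suc K)) (insert (int (Suc K)) {- int K..int K})"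
      by auto
    then have "(\<Sum>j\<in>{- int (Suc K)..int (Suc K)}. (1 / 2 :: real) ^ nat \<bar>j\<bar>) =
      (1 / 2) ^ nat \<bar>- int (Suc K)\<bar> + ((1 / 2) ^ nat \<bar>int (Suc K)\<bar> + (\<Sum>j\<in>{- int K..int K}. (1 / 2) ^ nat \<bar>j\<bar>))"
      by simp
    also have "\<dots> = (1 / 2) ^ Suc K + ((1 / 2) ^ Suc K + (\<Sum>j\<in>{- int K..int K}. (1 / 2) ^ nat \<bar>j\<bar>))"
      by (simp only: abs_minus_cancel abs_of_nat nat_int)
    finally show ?case by (simp add: Suc)
  qed simp
  then show ?thesis by simp
qed

text \<open>A generating function bound. The 1-norm of an integer vector is at most its squared
  norm, so \<open>2 ^ (4 * card V)\<close> times the product of the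
  \<open>(1 / 2) ^ nat \<bar>k i\<bar>\<close> is at least 1 on the set. Summed over the box it
  factorizes into geometric sums of at most 3, and \<open>2 ^ 4 * 3 = 48\<close>.\<close>

lemma card_norming_set:
  assumes "finite V"
  shows "real (card (norming_set V)) \<le> 48 ^ card V"
proof -
  let ?K = "4 * card V"
  let ?B = "V \<rightarrow>\<^sub>E {- int ?K..int ?K}"
  let ?h = "\<lambda>j::int. (1 / 2 :: real) ^ nat \<bar>j\<bar>"
  define S where "S = {k \<in> ?B. (\<Sum>i\<in>V. (k i)\<^sup>2) \<le> int ?K}"
  have "norming_set V \<subseteq> (\<lambda>k. \<lambda>i\<in>V. of_int (k i)) ` S"
  proof
    fix z assume z: "z \<in> norming_set V"
    define k where "k = (\<lambda>i\<in>V. \<lfloor>z i\<rfloor>)"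
    have zi: "z i \<in> of_int ` {- 4 * int (card V)..4 * int (card V)}" if "i \<in> V" for i
      using z that by (auto simp: norming_set_def)
    have zk: "z i = of_int (k i)" if "i \<in> V" for i
      using zi[OF that] that by (auto simp: k_def)
    have "k \<in> ?B"
      using zi by (force simp: k_def)
    moreover have "(\<Sum>i\<in>V. (k i)\<^sup>2) \<le> int ?K"
    proof -
      have "ip V z z = of_int (\<Sum>i\<in>V. (k i)\<^sup>2)"
        by (simp add: ip_def zk power2_eq_square)
      then have "of_int (\<Sum>i\<in>V. (k i)\<^sup>2) \<le> (of_int (int ?K) :: real)"
        using z by (simp add: norming_set_def)
      then show ?thesis by (simp only: of_int_le_iff)
    qed
    moreover have "z = (\<lambda>i\<in>V. of_int (k i))"
      using z zk by (auto simp: norming_set_def fun_eq_iff restrict_def PiE_def extensional_def)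
    ultimately show "z \<in> (\<lambda>k. \<lambda>i\<in>V. of_int (k i)) ` S"
      by (auto simp: S_def)
  qed
  moreover have finS: "finite S" and finB: "finite ?B"
    using assms by (auto simp: S_def intro!: finite_PiE)
  ultimately have "card (norming_set V) \<le> card S"
    by (meson card_image_le card_mono finite_imageI order.trans)
  then have "real (card (norming_set V)) \<le> (\<Sum>k\<in>S. 1)" by simp
  also have "\<dots> \<le> (\<Sum>k\<in>S. 2 ^ ?K * (\<Prod>i\<in>V. ?h (k i)))"
  proof (rule sum_mono)
    fix k assume "k \<in> S"
    have "(\<Sum>i\<in>V. \<bar>k i\<bar>) \<le> (\<Sum>i\<in>V. (k i)\<^sup>2)"
    proof (rule sum_mono)
      fix i show "\<bar>k i\<bar> \<le> (k i)\<^sup>2"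
      proof (cases "k i = 0")
        case False
        then have "\<bar>k i\<bar> * 1 \<le> \<bar>k i\<bar> * \<bar>k i\<bar>" by (intro mult_left_mono) auto
        then show ?thesis by (simp add: power2_eq_square abs_mult[symmetric])
      qed simp
    qed
    also have "\<dots> \<le> int ?K" using \<open>k \<in> S\<close> by (simp add: S_def)
    finally have "(\<Sum>i\<in>V. nat \<bar>k i\<bar>) \<le> ?K"
      by (simp flip: of_nat_le_iff[where 'a = int])
    then have "(1 / 2 :: real) ^ ?K \<le> (1 / 2) ^ (\<Sum>i\<in>V. nat \<bar>k i\<bar>)"
      by (intro power_decreasing) auto
    also have "\<dots> = (\<Prod>i\<in>V. ?h (k i))"
      by (rule power_sum)
    finally have "2 ^ ?K * (1 / 2 :: real) ^ ?K \<le> 2 ^ ?K * (\<Prod>i\<in>V. ?h (k i))"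
      by (intro mult_left_mono) auto
    moreover have "2 ^ ?K * (1 / 2 :: real) ^ ?K = 1"
      by (simp add: power_one_over)
    ultimately show "1 \<le> 2 ^ ?K * (\<Prod>i\<in>V. ?h (k i))" by linarith
  qed
  also have "\<dots> \<le> (\<Sum>k\<in>?B. 2 ^ ?K * (\<Prod>i\<in>V. ?h (k i)))"
    using finB by (intro sum_mono2) (auto simp: S_def intro!: mult_nonneg_nonneg prod_nonneg)
  also have "\<dots> = 2 ^ ?K * (\<Prod>i\<in>V. \<Sum>j\<in>{- int ?K..int ?K}. ?h j)"
    using assms by (subst prod_sum_PiE) (auto simp: sum_distrib_left)
  also have "\<dots> \<le> 2 ^ ?K * (\<Prod>i\<in>V. 3)"
    by (intro mult_left_mono prod_mono conjI sum_half_powers_le_3 sum_nonneg) auto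
  also have "\<dots> = 48 ^ card V"
    by (simp add: power_mult power_mult_distrib[symmetric])
  finally show ?thesis .
qed

text \<open>The largest form over pairs of test vectors controls the operator norm. Replacing the
  maximum by the sum of all powers gives an expression that can be averaged termwise.\<close>

lemma power_trace_le_norming_sum:
  assumes sym: "\<And>i j. M i j = M j i" and fin: "finite V" and "V \<noteq> {}"
  shows "real (card V) ^ (2 * m) * power_trace V M (2 * m)
    \<le> real (card V) * (\<Sum>z\<in>norming_set V. \<Sum>z'\<in>norming_set V. (ip V z (mv V M z')) ^ (2 * m))"
proof -
  let ?T = "norming_set V" and ?r = "real (card V)"
  have "0 < ?r" using assms by (simp add: card_gt_0_iff)
  have finT: "finite ?T" by (rule finite_norming_set[OF fin])
  define Q where "Q = (\<lambda>(z, z'). (ip V z (mv V M z'))\<^sup>2) ` (?T \<times> ?T)"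
  have "finite Q" "Q \<noteq> {}"
    using finT norming_set_nonempty[of V] by (auto simp: Q_def)
  define B where "B = Max Q"
  have B_ge: "(ip V z (mv V M z'))\<^sup>2 \<le> B" if "z \<in> ?T" "z' \<in> ?T" for z z'
    unfolding B_def using that \<open>finite Q\<close> by (intro Max_ge) (auto simp: Q_def)
  have "B \<in> Q" unfolding B_def using \<open>finite Q\<close> \<open>Q \<noteq> {}\<close> by (rule Max_in)
  then obtain z0 z0' where z0: "z0 \<in> ?T" "z0' \<in> ?T" "B = (ip V z0 (mv V M z0'))\<^sup>2"
    by (auto simp: Q_def)
  \<comment> \<open>\<open>z\<close> tests the vector \<open>M x\<close>, symmetry moves
    \<open>M\<close> onto \<open>z\<close>, and \<open>z'\<close> tests \<open>M z\<close>. Each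
    test gains a factor \<open>card V\<close>, hence the square.\<close>
  have op: "ip V (mv V M x) (mv V M x) \<le> B / ?r\<^sup>2 * ip V x x" for x
  proof -
    obtain z where z: "z \<in> ?T" "?r * ip V (mv V M x) (mv V M x) \<le> (ip V z (mv V M x))\<^sup>2"
      using norming_set_norming[OF fin \<open>V \<noteq> {}\<close>] by blast
    obtain z' where z': "z' \<in> ?T" "?r * ip V (mv V M z) (mv V M z) \<le> (ip V z' (mv V M z))\<^sup>2"
      using norming_set_norming[OF fin \<open>V \<noteq> {}\<close>] by blast
    have "?r * (?r * ip V (mv V M x) (mv V M x)) \<le> ?r * (ip V (mv V M z) x)\<^sup>2"
      using z(2) \<open>0 < ?r\<close> by (intro mult_left_mono) (simp_all add: ip_mv_commute sym)
    also have "\<dots> \<le> ?r * (ip V (mv V M z) (mv V M z) * ip V x x)"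
      using \<open>0 < ?r\<close> by (intro mult_left_mono ip_Cauchy_Schwarz) auto
    also have "\<dots> = ?r * ip V (mv V M z) (mv V M z) * ip V x x"
      by simp
    also have "\<dots> \<le> B * ip V x x"
      using z'(2) B_ge[OF z'(1) z(1)] by (intro mult_right_mono ip_self_nonneg) linarith
    finally show ?thesis
      using \<open>0 < ?r\<close> by (simp add: field_simps power2_eq_square)
  qed
  have "power_trace V M (2 * m) \<le> ?r * (B / ?r\<^sup>2) ^ m"
    using op z0 by (intro power_trace_le sym fin) auto
  also have "\<dots> = ?r * B ^ m / ?r ^ (2 * m)"
    by (simp add: power_divide power_mult)
  finally have "?r ^ (2 * m) * power_trace V M (2 * m) \<le> ?r * B ^ m"
    using \<open>0 < ?r\<close> by (simp add: pos_le_divide_eq mult.commute)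
  also have "B ^ m \<le> (\<Sum>z\<in>?T. \<Sum>z'\<in>?T. (ip V z (mv V M z')) ^ (2 * m))"
  proof -
    have "B ^ m = (ip V z0 (mv V M z0')) ^ (2 * m)"
      by (simp add: z0(3) power_mult)
    also have "\<dots> \<le> (\<Sum>z'\<in>?T. (ip V z0 (mv V M z')) ^ (2 * m))"
      using z0 finT by (intro member_le_sum[of z0']) auto
    also have "\<dots> \<le> (\<Sum>z\<in>?T. \<Sum>z'\<in>?T. (ip V z (mv V M z')) ^ (2 * m))"
      using z0 finT by (intro member_le_sum[of z0]) (auto intro!: sum_nonneg)
    finally show ?thesis .
  qed
  finally show ?thesis using \<open>0 < ?r\<close> by simp
qed

text \<open>The 4 absorbs the linear prefactor, \<open>48 ^ 4\<close> the number of pairs of test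
  vectors on \<open>2 * m\<close> vertices, and \<open>exp 512\<close> the exponential
  moment.\<close>

definition good_walk_const :: real where
  "good_walk_const = 4 * 48 ^ 4 * exp 512"

lemma good_walk_const_ge_1: "1 \<le> good_walk_const"
proof -
  have "1 * 1 \<le> (4 * 48 ^ 4) * exp (512 :: real)"
    by (intro mult_mono) auto
  then show ?thesis by (simp add: good_walk_const_def)
qed

text \<open>The number of pairs of test vectors is only exponential in \<open>m\<close>, so the
  order \<open>m ^ m\<close> is decided by a single moment of a bilinear form.\<close>

lemma card_good_walks_le:
  assumes fin: "finite V" and card: "card V = 2 * m" and "0 < m"
  shows "real (card (good_walks V (2 * m))) \<le> (good_walk_const * real m) ^ m"
proof -
  let ?P = "vertex_pairs V" and ?T = "norming_set V" and ?r = "real (card V)"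
  let ?E = "\<lambda>f z z'. (ip V z (mv V (edge_matrix f) z')) ^ (2 * m)"
  have "V \<noteq> {}" and r: "?r = 2 * real m" using card \<open>0 < m\<close> by auto
  let ?C = "2 * ?r ^ (2 * m) * real m ^ m * exp 512 ^ m"
  have moment: "skew_avg ?P (\<lambda>f. ?E f z z') \<le> ?C" if "z \<in> ?T" "z' \<in> ?T" for z z'
  proof -
    \<comment> \<open>The sum of squared coefficients is at most \<open>128 * m ^ 2\<close>, so this
      scale makes the exponent \<open>512 * m\<close>, linear in \<open>m\<close>, while
      \<open>1 / t ^ (2 * m)\<close> is only \<open>m ^ m\<close>.\<close>
    define t where "t = 1 / sqrt (real m)"
    have t: "0 < t" "t\<^sup>2 = 1 / real m"
      using \<open>0 < m\<close> by (simp_all add: t_def power_divide)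
    have "(\<Sum>e\<in>?P. (pair_coeff V z z' e)\<^sup>2) \<le> 2 * ip V z z * ip V z' z'"
      by (rule sum_pair_coeff_squared[OF fin])
    also have "\<dots> \<le> 2 * (4 * ?r) * (4 * ?r)"
      using that by (intro mult_mono) (auto simp: norming_set_def ip_self_nonneg)
    finally have "4 * t\<^sup>2 * (\<Sum>e\<in>?P. (pair_coeff V z z' e)\<^sup>2) \<le> 4 * t\<^sup>2 * (2 * (4 * ?r) * (4 * ?r))"
      by (intro mult_left_mono) auto
    also have "\<dots> = 512 * real m"
      using \<open>0 < m\<close> by (simp add: t r)
    finally have ex: "exp (4 * t\<^sup>2 * (\<Sum>e\<in>?P. (pair_coeff V z z' e)\<^sup>2)) \<le> exp 512 ^ m"
      by (simp add: exp_of_nat_mult[symmetric] mult.commute)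
    have tm: "t ^ (2 * m) = 1 / real m ^ m"
      by (simp add: power_mult t power_one_over)
    have "skew_avg ?P (\<lambda>f. ?E f z z')
      \<le> 2 * fact (2 * m) / t ^ (2 * m) * exp (4 * t\<^sup>2 * (\<Sum>e\<in>?P. (pair_coeff V z z' e)\<^sup>2))"
      unfolding bilinear_edge_matrix[OF fin]
      by (rule skew_avg_even_power[OF finite_vertex_pairs[OF fin] t(1)])
    also have "\<dots> = 2 * fact (2 * m) * real m ^ m * exp (4 * t\<^sup>2 * (\<Sum>e\<in>?P. (pair_coeff V z z' e)\<^sup>2))"
      by (simp add: tm)
    also have "\<dots> \<le> 2 * fact (2 * m) * real m ^ m * exp 512 ^ m"
      using ex by (intro mult_left_mono) auto
    also have "\<dots> \<le> 2 * ?r ^ (2 * m) * real m ^ m * exp 512 ^ m"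
    proof (intro mult_right_mono mult_left_mono)
      \<comment> \<open>The factorial is absorbed by the power of \<open>card V\<close> that
        normalizes the test vectors and cancels below.\<close>
      have "fact (2 * m) \<le> real ((2 * m) ^ (2 * m))"
        by (metis fact_le_power le_refl of_nat_fact of_nat_le_iff of_nat_id)
      then show "fact (2 * m) \<le> ?r ^ (2 * m)" by (simp add: r)
    qed auto
    finally show ?thesis .
  qed
  have "?r ^ (2 * m) * real (card (good_walks V (2 * m)))
    \<le> ?r ^ (2 * m) * skew_avg ?P (\<lambda>f. power_trace V (edge_matrix f) (2 * m))"
    using \<open>0 < m\<close> by (intro mult_left_mono card_good_walks_le_skew_avg fin) auto
  also have "\<dots> = skew_avg ?P (\<lambda>f. ?r ^ (2 * m) * power_trace V (edge_matrix f) (2 * m))"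
    by (rule skew_avg_cmult[symmetric])
  also have "\<dots> \<le> skew_avg ?P (\<lambda>f. ?r * (\<Sum>z\<in>?T. \<Sum>z'\<in>?T. ?E f z z'))"
    by (intro skew_avg_mono power_trace_le_norming_sum fin \<open>V \<noteq> {}\<close>) (rule edge_matrix_sym)
  also have "\<dots> = ?r * (\<Sum>z\<in>?T. \<Sum>z'\<in>?T. skew_avg ?P (\<lambda>f. ?E f z z'))"
    by (simp only: skew_avg_cmult skew_avg_sum)
  also have "\<dots> \<le> ?r * (\<Sum>z\<in>?T. \<Sum>z'\<in>?T. ?C)"
    by (intro mult_left_mono sum_mono moment) auto
  also have "\<dots> = ?r ^ (2 * m) * (2 * ?r * (real (card ?T))\<^sup>2 * real m ^ m * exp 512 ^ m)"
    by (simp add: power2_eq_square mult_ac)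
  finally have "real (card (good_walks V (2 * m))) \<le> 2 * ?r * (real (card ?T))\<^sup>2 * real m ^ m * exp 512 ^ m"
    by (rule mult_left_le_imp_le) (use r \<open>0 < m\<close> in simp)
  also have "\<dots> \<le> 4 ^ m * (48 ^ 4) ^ m * real m ^ m * exp 512 ^ m"
  proof (intro mult_right_mono mult_mono)
    have "m - 1 < 4 ^ (m - 1)"
      by (rule less_exp[THEN order.strict_trans2]) (simp add: power_mono)
    then have "4 * m \<le> 4 * 4 ^ (m - 1)" by linarith
    also have "\<dots> = 4 ^ m" using \<open>0 < m\<close> by (cases m) auto
    finally have "real (4 * m) \<le> real (4 ^ m)" by (simp only: of_nat_le_iff)
    then show "2 * ?r \<le> 4 ^ m" by (simp add: r)
    have "(real (card ?T))\<^sup>2 \<le> (48 ^ card V)\<^sup>2"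
      by (intro power_mono card_norming_set fin) auto
    then show "(real (card ?T))\<^sup>2 \<le> (48 ^ 4) ^ m"
      unfolding card power_mult[symmetric] by (simp add: mult.commute[of m])
  qed auto
  also have "\<dots> = (good_walk_const * real m) ^ m"
    by (simp only: good_walk_const_def power_mult_distrib mult_ac)
  finally show ?thesis .
qed

subsection \<open>Jumbledness of random graphs\<close>

lemma potential_edges_eq: "potential_edges N = vertex_pairs {1..N}"
  by (simp add: potential_edges_def vertex_pairs_def)

text \<open>Ordered pairs count an edge once per orientation that fits into
  \<open>U \<times> V\<close>; both fit exactly when the edge lies inside
  \<open>U \<inter> V\<close>.\<close>

lemma edges_between_eq_sum:
  assumes "E \<subseteq> vertex_pairs W" "finite W" "U \<subseteq> W" "V \<subseteq> W"
  shows "real (edges_between E U V) = (\<Sum>(u, v)\<in>U \<times> V. indicator E {u, v})"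
proof -
  let ?Q = "{q\<in>U \<times> V. (\<lambda>(u, v). {u, v}) q \<in> E}"
  have finE: "finite E" and finUV: "finite (U \<times> V)"
    using assms finite_vertex_pairs[of W] by (auto intro: finite_subset)
  have *: "card {q\<in>?Q. (\<lambda>(u, v). {u, v}) q = e} =
      of_bool (\<exists>u\<in>U. \<exists>v\<in>V. e = {u, v}) + of_bool (e \<subseteq> U \<inter> V)" if "e \<in> E" for e
  proof -
    have "e \<in> vertex_pairs W" using that assms(1) by auto
    then obtain a b where ab: "e = {a, b}" "a \<noteq> b"
      by (auto simp: vertex_pairs_def card_2_iff)
    have pairs: "{q\<in>?Q. (\<lambda>(u, v). {u, v}) q = e} =
      (if a \<in> U \<and> b \<in> V then {(a, b)} else {}) \<union> (if b \<in> U \<and> a \<in> V then {(b, a)} else {})"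
    proof -
      have "{b, a} \<in> E" using ab(1) that by (simp add: insert_commute)
      then have "{q\<in>?Q. (\<lambda>(u, v). {u, v}) q = e} = {q\<in>U \<times> V. q = (a, b) \<or> q = (b, a)}"
        using ab that by (auto simp: doubleton_eq_iff)
      then show ?thesis by auto
    qed
    have between: "(\<exists>u\<in>U. \<exists>v\<in>V. e = {u, v}) \<longleftrightarrow> a \<in> U \<and> b \<in> V \<or> b \<in> U \<and> a \<in> V"
      unfolding ab(1) doubleton_eq_iff by blast
    have inside: "e \<subseteq> U \<inter> V \<longleftrightarrow> a \<in> U \<and> a \<in> V \<and> b \<in> U \<and> b \<in> V"
      unfolding ab(1) by blast
    show ?thesis
      unfolding pairs between inside using ab(2) by (cases "a \<in> U"; cases "b \<in> U"; cases "a \<in> V"; cases "b \<in> V") simp_all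
  qed
  have "(\<Sum>(u, v)\<in>U \<times> V. indicator E {u, v}) = (\<Sum>q\<in>?Q. 1 :: real)"
    unfolding sum.inter_filter[OF finUV]
    by (intro sum.cong refl) (auto simp: indicator_def split: prod.splits)
  also have "\<dots> = (\<Sum>e\<in>E. \<Sum>q\<in>{q\<in>?Q. (\<lambda>(u, v). {u, v}) q = e}. 1)"
    using finE finUV by (subst sum.group) auto
  also have "\<dots> = (\<Sum>e\<in>E. real (card {q\<in>?Q. (\<lambda>(u, v). {u, v}) q = e}))"
    by simp
  also have "\<dots> = (\<Sum>e\<in>E. real (of_bool (\<exists>u\<in>U. \<exists>v\<in>V. e = {u, v}) + of_bool (e \<subseteq> U \<inter> V)))"
    by (intro sum.cong refl arg_cong[of _ _ real] *)
  also have "\<dots> = real (edges_between E U V)"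
    using finE by (simp add: edges_between_def sum.distrib sum_of_bool_eq Int_def)
  finally show ?thesis by simp
qed

abbreviation centered :: "real \<Rightarrow> 'a set set \<Rightarrow> 'a set \<Rightarrow> real" where
  "centered p E \<equiv> (\<lambda>e. indicator E e - p)"

text \<open>The matrix is zero on the diagonal where the discrepancy has \<open>- p\<close>; the
  difference is one \<open>p\<close> for each vertex of \<open>U \<inter> V\<close>.\<close>

lemma edges_between_bilinear:
  assumes "E \<subseteq> vertex_pairs W" "finite W" "U \<subseteq> W" "V \<subseteq> W"
  shows "real (edges_between E U V) - p * real (card U) * real (card V) =
    ip W (indicator U) (mv W (edge_matrix (centered p E)) (indicator V)) - p * real (card (U \<inter> V))"
proof -
  have fin: "finite U" "finite V" using assms by (auto intro: finite_subset)
  have noloop: "{v} \<notin> E" for v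
    using assms(1) by (auto simp: vertex_pairs_def)
  have "ip W (indicator U) (mv W (edge_matrix (centered p E)) (indicator V))
    = (\<Sum>u\<in>W. \<Sum>v\<in>W. indicator U u * (edge_matrix (centered p E) u v * indicator V v))"
    by (simp add: ip_def mv_def sum_distrib_left)
  also have "\<dots> = (\<Sum>u\<in>U. \<Sum>v\<in>V. edge_matrix (centered p E) u v)"
  proof -
    have "(\<Sum>v\<in>W. indicator U u * (edge_matrix (centered p E) u v * indicator V v))
      = indicator U u * (\<Sum>v\<in>V. edge_matrix (centered p E) u v)" for u
      unfolding sum_distrib_left[symmetric]
      by (intro arg_cong[of _ _ "(*) _"] sum.mono_neutral_cong_right) (use assms in \<open>auto simp: indicator_def\<close>)
    moreover have "(\<Sum>u\<in>W. indicator U u * (\<Sum>v\<in>V. edge_matrix (centered p E) u v))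
      = (\<Sum>u\<in>U. \<Sum>v\<in>V. edge_matrix (centered p E) u v)"
      by (intro sum.mono_neutral_cong_right) (use assms in \<open>auto simp: indicator_def\<close>)
    ultimately show ?thesis by simp
  qed
  also have "\<dots> = (\<Sum>u\<in>U. \<Sum>v\<in>V. indicator E {u, v} - p + p * of_bool (u = v))"
    using noloop by (intro sum.cong refl) (auto simp: edge_matrix_def indicator_def)
  also have "\<dots> = (\<Sum>u\<in>U. \<Sum>v\<in>V. indicator E {u, v}) - p * real (card U) * real (card V)
      + p * (\<Sum>u\<in>U. \<Sum>v\<in>V. of_bool (u = v))"
    by (simp add: sum.distrib sum_subtractf sum_distrib_left)
  also have "(\<Sum>u\<in>U. \<Sum>v\<in>V. of_bool (u = v)) = (\<Sum>u\<in>U. of_bool (u \<in> V) :: real)"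
    using fin by (intro sum.cong refl) (simp add: of_bool_def)
  also have "\<dots> = real (card (U \<inter> V))"
    using fin by (simp add: sum_of_bool_eq Int_def)
  finally show ?thesis
    using edges_between_eq_sum[OF assms] by (simp add: sum.cartesian_product)
qed

text \<open>\<open>card (U \<inter> V)\<close> is at most the geometric mean of
  \<open>card U\<close> and \<open>card V\<close>, so the diagonal correction only lowers
  \<open>\<alpha>\<close> to \<open>\<alpha> - p\<close>. Powers of that mean then cancel in
  \<open>bilinear_form_power_le_trace\<close>.\<close>

lemma not_jumbled_imp_trace_ge:
  assumes E: "E \<subseteq> vertex_pairs W" and fin: "finite W" and "\<not> jumbled p \<alpha> W E" and "0 < p" "p < \<alpha>"
  shows "(\<alpha> - p) ^ (2 * 2 ^ s) \<le> power_trace W (edge_matrix (centered p E)) (2 * 2 ^ s)"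
proof -
  let ?tr = "power_trace W (edge_matrix (centered p E)) (2 * 2 ^ s)"
  obtain U V where UV: "U \<subseteq> W" "V \<subseteq> W" and
    gt: "\<alpha> * sqrt (real (card U) * real (card V)) < \<bar>real (edges_between E U V) - p * real (card U) * real (card V)\<bar>"
    using assms(3) by (auto simp: jumbled_def not_le)
  define S where "S = sqrt (real (card U) * real (card V))"
  define b where "b = ip W (indicator U) (mv W (edge_matrix (centered p E)) (indicator V))"
  have finUV: "finite U" "finite V" using UV fin by (auto intro: finite_subset)
  have "real (card (U \<inter> V)) = sqrt (real (card (U \<inter> V)) * real (card (U \<inter> V)))"
    by simp
  also have "\<dots> \<le> S"
    unfolding S_def using finUV
    by (intro real_sqrt_le_mono mult_mono of_nat_mono card_mono) auto
  finally have "p * real (card (U \<inter> V)) \<le> p * S" using assms by simp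
  moreover have "0 \<le> p * real (card (U \<inter> V))" using assms by simp
  ultimately have lt: "(\<alpha> - p) * S < \<bar>b\<bar>"
    using gt unfolding edges_between_bilinear[OF E fin UV] b_def[symmetric] S_def[symmetric]
    by (simp add: left_diff_distrib)
  have "0 \<le> S" by (simp add: S_def)
  have ipU: "ip W (indicator A) (indicator A) = real (card A)" if "A \<subseteq> W" for A
  proof -
    have "ip W (indicator A) (indicator A) = (\<Sum>i\<in>A. 1)"
      unfolding ip_def by (intro sum.mono_neutral_cong_right) (use that fin in \<open>auto simp: indicator_def\<close>)
    then show ?thesis by simp
  qed
  have "((\<alpha> - p) * S) ^ (2 * 2 ^ s) \<le> \<bar>b\<bar> ^ (2 * 2 ^ s)"
    using lt assms \<open>0 \<le> S\<close> by (intro power_mono) auto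
  also have "\<dots> = b ^ (2 * 2 ^ s)"
    by (simp add: power_mult)
  also have "\<dots> \<le> real (card U) ^ (2 ^ s) * real (card V) ^ (2 ^ s) * ?tr"
    using bilinear_form_power_le_trace[of "edge_matrix (centered p E)" W "indicator U" "indicator V" s,
        OF edge_matrix_sym fin]
    unfolding b_def ipU[OF UV(1)] ipU[OF UV(2)] .
  also have "\<dots> = S ^ (2 * 2 ^ s) * ?tr"
    by (simp add: S_def power_mult power_mult_distrib)
  finally have le: "S ^ (2 * 2 ^ s) * (\<alpha> - p) ^ (2 * 2 ^ s) \<le> S ^ (2 * 2 ^ s) * ?tr"
    by (simp add: power_mult_distrib mult.commute)
  \<comment> \<open>An empty \<open>U\<close> or \<open>V\<close> would make both sides of the
    strict inequality \<open>lt\<close> zero.\<close>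
  have "S \<noteq> 0"
  proof
    assume "S = 0"
    then have "U = {} \<or> V = {}" using finUV by (auto simp: S_def)
    then have "b = 0" by (auto simp: b_def ip_def mv_def)
    then show False using lt \<open>S = 0\<close> by simp
  qed
  then have "0 < S ^ (2 * 2 ^ s)" using \<open>0 \<le> S\<close> by simp
  with le show ?thesis by (rule mult_left_le_imp_le)
qed

section \<open>Expected traces and Markov's inequality\<close>

lemma bernoulli_central_moment_le:
  fixes p :: real
  assumes "0 < p" "p < 1" "2 \<le> j"
  shows "\<bar>p * (1 - p) ^ j + (1 - p) * (- p) ^ j\<bar> \<le> p"
proof -
  have "\<bar>p * (1 - p) ^ j + (1 - p) * (- p) ^ j\<bar> \<le> \<bar>p * (1 - p) ^ j\<bar> + \<bar>(1 - p) * (- p) ^ j\<bar>"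
    by (rule abs_triangle_ineq)
  also have "\<dots> = p * (1 - p) ^ j + (1 - p) * p ^ j"
    using assms by (simp add: abs_mult power_abs)
  \<comment> \<open>Both bases lie in the unit interval, which reduces to the variance
    \<open>p * (1 - p)\<close>.\<close>
  also have "\<dots> \<le> p * (1 - p) ^ 2 + (1 - p) * p ^ 2"
    using assms by (intro add_mono mult_left_mono power_decreasing) auto
  also have "\<dots> = p * (1 - p)" by algebra
  also have "\<dots> \<le> p * 1" using assms by (intro mult_left_mono) auto
  finally show ?thesis by simp
qed

text \<open>A walk of length \<open>n\<close> has at most \<open>n\<close> edges, so
  \<open>n\<close>-wise independence factorizes its expectation into central moments, each at most
  \<open>p\<close> once the edge is repeated.\<close>

lemma expectation_power_trace_le:
  fixes D :: "'a set set pmf"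
  assumes fin: "finite W" and supp: "set_pmf D \<subseteq> Pow (vertex_pairs W)"
    and p: "0 < p" "p < 1" "\<And>e. e \<in> vertex_pairs W \<Longrightarrow> measure_pmf.prob D {E. e \<in> E} = p"
    and indep: "\<And>S. S \<subseteq> vertex_pairs W \<Longrightarrow> card S \<le> n \<Longrightarrow>
      prob_space.indep_vars (measure_pmf D) (\<lambda>_. borel) (\<lambda>e E. indicator E e :: real) S"
    and "0 < n"
  shows "measure_pmf.expectation D (\<lambda>E. power_trace W (edge_matrix (centered p E)) n)
    \<le> (\<Sum>w\<in>good_walks W n. p ^ (card (set w) - 1))"
proof -
  let ?L = "{w\<in>closed_walks W n. loopless w}"
  have finD: "finite (set_pmf D)"
    using supp fin finite_vertex_pairs[of W] by (auto intro: finite_subset)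
  have int[simp]: "integrable (measure_pmf D) f" for f :: "'a set set \<Rightarrow> real"
    by (rule integrable_measure_pmf_finite[OF finD])
  define \<mu> where "\<mu> j = p * (1 - p) ^ j + (1 - p) * (- p) ^ j" for j :: nat
  have moment: "measure_pmf.expectation D (\<lambda>E. (centered p E e) ^ j) = \<mu> j" if "e \<in> vertex_pairs W" for e j
  proof -
    have "measure_pmf.expectation D (\<lambda>E. (centered p E e) ^ j) =
      measure_pmf.expectation D (\<lambda>E. (- p) ^ j + ((1 - p) ^ j - (- p) ^ j) * indicator {E. e \<in> E} E)"
      by (intro Bochner_Integration.integral_cong) (auto simp: indicator_def)
    also have "\<dots> = (- p) ^ j + ((1 - p) ^ j - (- p) ^ j) * p"
      using p(3)[OF that] by simp
    finally show ?thesis by (simp add: \<mu>_def algebra_simps)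
  qed
  have walk: "measure_pmf.expectation D (\<lambda>E. \<Prod>e\<in>walk_edges w. centered p E e ^ edge_mult w e)
      = (\<Prod>e\<in>walk_edges w. \<mu> (edge_mult w e))" if "w \<in> ?L" for w
  proof -
    have sub: "walk_edges w \<subseteq> vertex_pairs W"
      using that by (intro walk_edges_loopless[of _ _ n]) auto
    have "card (walk_edges w) \<le> n"
      using card_walk_edges_le[of w] that by (simp add: closed_walks_def)
    then have "prob_space.indep_vars (measure_pmf D) (\<lambda>_. borel) (\<lambda>e E. indicator E e :: real) (walk_edges w)"
      using sub by (intro indep)
    then have "prob_space.indep_vars (measure_pmf D) (\<lambda>_. borel) (\<lambda>e E. centered p E e ^ edge_mult w e) (walk_edges w)"
      by (rule prob_space.indep_vars_compose2[OF prob_space_measure_pmf, where Y = "\<lambda>e x. (x - p) ^ edge_mult w e"]) auto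
    then have "measure_pmf.expectation D (\<lambda>E. \<Prod>e\<in>walk_edges w. centered p E e ^ edge_mult w e)
      = (\<Prod>e\<in>walk_edges w. measure_pmf.expectation D (\<lambda>E. centered p E e ^ edge_mult w e))"
      by (intro prob_space.indep_vars_lebesgue_integral prob_space_measure_pmf) (auto simp: finite_walk_edges)
    also have "\<dots> = (\<Prod>e\<in>walk_edges w. \<mu> (edge_mult w e))"
      using sub by (intro prod.cong refl moment) auto
    finally show ?thesis .
  qed
  have "measure_pmf.expectation D (\<lambda>E. power_trace W (edge_matrix (centered p E)) n)
    = (\<Sum>w\<in>?L. measure_pmf.expectation D (\<lambda>E. \<Prod>e\<in>walk_edges w. centered p E e ^ edge_mult w e))"
    unfolding power_trace_edge_matrix[OF fin \<open>0 < n\<close>] by (intro Bochner_Integration.integral_sum) simp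
  also have "\<dots> = (\<Sum>w\<in>?L. \<Prod>e\<in>walk_edges w. \<mu> (edge_mult w e))"
    by (intro sum.cong refl walk)
  also have "\<dots> = (\<Sum>w\<in>good_walks W n. \<Prod>e\<in>walk_edges w. \<mu> (edge_mult w e))"
  \<comment> \<open>A loopless walk that is not good has an edge of multiplicity 1, whose first
    central moment is 0.\<close>
  proof (intro sum.mono_neutral_right ballI)
    fix w assume "w \<in> ?L - good_walks W n"
    then obtain e where e: "e \<in> walk_edges w" "\<not> 2 \<le> edge_mult w e"
      by (auto simp: good_walks_def)
    then have "edge_mult w e = 1" using edge_mult_pos[OF e(1)] by linarith
    then have "\<mu> (edge_mult w e) = 0" by (simp add: \<mu>_def)
    then show "(\<Prod>e\<in>walk_edges w. \<mu> (edge_mult w e)) = 0"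
      using e(1) finite_walk_edges by (intro prod_zero) auto
  qed (use fin in \<open>auto simp: finite_closed_walks good_walks_def\<close>)
  also have "\<dots> \<le> (\<Sum>w\<in>good_walks W n. p ^ (card (set w) - 1))"
  proof (rule sum_mono)
    fix w assume w: "w \<in> good_walks W n"
    have "(\<Prod>e\<in>walk_edges w. \<mu> (edge_mult w e)) \<le> (\<Prod>e\<in>walk_edges w. \<bar>\<mu> (edge_mult w e)\<bar>)"
      by (metis abs_ge_self abs_prod)
    also have "\<dots> \<le> (\<Prod>e\<in>walk_edges w. p)"
      using w p unfolding \<mu>_def
      by (intro prod_mono conjI abs_ge_zero bernoulli_central_moment_le) (auto simp: good_walks_def)
    also have "\<dots> = p ^ card (walk_edges w)" by simp
    also have "\<dots> \<le> p ^ (card (set w) - 1)"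
      using card_set_le_walk_edges[of w] p by (intro power_decreasing) auto
    finally show "(\<Prod>e\<in>walk_edges w. \<mu> (edge_mult w e)) \<le> p ^ (card (set w) - 1)" .
  qed
  finally show ?thesis .
qed

text \<open>On \<open>2 * m\<close> vertices a walk with \<open>v + 1\<close> distinct vertices has
  weight \<open>N / m * (p * N / m) ^ v\<close>. The last hypothesis makes \<open>?q\<close> at
  least 1, so \<open>v\<close> can be raised to \<open>m\<close>, and the \<open>m ^ m\<close> from
  the walk count cancels.\<close>

lemma sum_good_walks_le:
  assumes fin: "finite W" and "0 < m" and p: "0 < p"
    and c: "0 < c" "c \<le> 1" "c * real m \<le> p * real (card W)"
  shows "(\<Sum>w\<in>good_walks W (2 * m). p ^ (card (set w) - 1))
    \<le> real (card W) * (good_walk_const * (p * real (card W)) / c) ^ m"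
proof -
  let ?N = "real (card W)" and ?V = "{..<2 * m}"
  let ?q = "p * ?N / (c * real m)"
  have "1 \<le> ?q" using c \<open>0 < m\<close> by simp
  have "0 \<le> ?N" by simp
  have "(\<Sum>w\<in>good_walks W (2 * m). p ^ (card (set w) - 1))
    \<le> (\<Sum>w\<in>good_walks ?V (2 * m). p ^ (card (set w) - 1) * (?N / real m) ^ card (set w))"
    using fin \<open>0 < m\<close> p by (intro good_walks_compare[where g = "\<lambda>v. p ^ (v - 1)"]) auto
  also have "\<dots> \<le> (\<Sum>w\<in>good_walks ?V (2 * m). ?N * ?q ^ m)"
  proof (rule sum_mono)
    fix w assume w: "w \<in> good_walks ?V (2 * m)"
    then have "w \<noteq> []" using \<open>0 < m\<close> by (auto simp: good_walks_def closed_walks_def)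
    then obtain v where v: "card (set w) = Suc v"
      by (cases "card (set w)") auto
    have "v \<le> m" using card_set_good[OF w] v by simp
    have "p ^ (card (set w) - 1) * (?N / real m) ^ card (set w) = ?N / real m * (p * ?N / real m) ^ v"
      by (simp add: v power_mult_distrib power_divide)
    also have "\<dots> \<le> ?N * ?q ^ m"
    proof (intro mult_mono)
      show "?N / real m \<le> ?N"
        using \<open>0 < m\<close> mult_left_mono[of 1 "real m" ?N] by (simp add: pos_divide_le_eq)
      have "p * ?N / real m \<le> ?q"
        using c \<open>0 < m\<close> p by (intro divide_left_mono) auto
      then have "(p * ?N / real m) ^ v \<le> ?q ^ v"
        using p by (intro power_mono) auto
      also have "\<dots> \<le> ?q ^ m"
        using \<open>1 \<le> ?q\<close> \<open>v \<le> m\<close> by (intro power_increasing) auto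
      finally show "(p * ?N / real m) ^ v \<le> ?q ^ m" .
    qed (use p in auto)
    finally show "p ^ (card (set w) - 1) * (?N / real m) ^ card (set w) \<le> ?N * ?q ^ m" .
  qed
  also have "\<dots> = real (card (good_walks ?V (2 * m))) * (?N * ?q ^ m)"
    by simp
  also have "\<dots> \<le> (good_walk_const * real m) ^ m * (?N * ?q ^ m)"
    using card_good_walks_le[of ?V m] \<open>0 < m\<close> \<open>1 \<le> ?q\<close> by (intro mult_right_mono) auto
  also have "\<dots> = ?N * (good_walk_const * real m * ?q) ^ m"
    by (simp only: power_mult_distrib mult_ac)
  also have "good_walk_const * real m * ?q = good_walk_const * (p * ?N) / c"
    using \<open>0 < m\<close> by simp
  finally show ?thesis .
qed

text \<open>Markov's inequality for the nonnegative even trace. Independence is needed up to the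
  full exponent \<open>2 * 2 ^ s\<close>, whereas \<open>2 ^ s\<close> is the \<open>m\<close> of
  the walk count.\<close>

lemma prob_not_jumbled_le:
  assumes G: "kwise_indep_random_graph k p G" and p: "0 < p N" "p N < 1" and "p N < a"
    and k: "2 * 2 ^ s \<le> k N"
    and c: "0 < c" "c \<le> 1" "c * 2 ^ s \<le> p N * real N"
  shows "1 - measure_pmf.prob (G N) {E. jumbled (p N) a {1..N} E}
    \<le> real N * (good_walk_const * (p N * real N) / c / (a - p N)\<^sup>2) ^ (2 ^ s)"
proof -
  let ?n = "2 * 2 ^ s :: nat"
  let ?tr = "\<lambda>E. power_trace {1..N} (edge_matrix (centered (p N) E)) ?n"
  let ?D = "measure_pmf (G N)"
  have supp: "set_pmf (G N) \<subseteq> Pow (vertex_pairs {1..N})"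
    using G by (simp add: kwise_indep_random_graph_def potential_edges_eq)
  have finD: "finite (set_pmf (G N))"
    using supp finite_vertex_pairs[of "{1..N}"] by (auto intro: finite_subset)
  have "measure_pmf.expectation (G N) ?tr \<le> (\<Sum>w\<in>good_walks {1..N} ?n. p N ^ (card (set w) - 1))"
    using G p k supp
    by (intro expectation_power_trace_le) (auto simp: kwise_indep_random_graph_def potential_edges_eq)
  also have "\<dots> \<le> real N * (good_walk_const * (p N * real N) / c) ^ (2 ^ s)"
    using sum_good_walks_le[of "{1..N}" "2 ^ s" "p N" c] p c by simp
  finally have ex: "measure_pmf.expectation (G N) ?tr \<le> real N * (good_walk_const * (p N * real N) / c) ^ (2 ^ s)" .
  have "1 - measure_pmf.prob (G N) {E. jumbled (p N) a {1..N} E}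
    = measure_pmf.prob (G N) (space ?D - {E. jumbled (p N) a {1..N} E})"
    by (subst measure_pmf.prob_compl) auto
  \<comment> \<open>The inclusion of events holds on the support, whose elements are graphs on
    \<open>{1..N}\<close>.\<close>
  also have "\<dots> \<le> measure_pmf.prob (G N) {E\<in>space ?D. (a - p N) ^ ?n \<le> ?tr E}"
    using supp p \<open>p N < a\<close>
    by (intro measure_pmf.finite_measure_mono_AE)
       (auto simp: AE_measure_pmf_iff intro!: not_jumbled_imp_trace_ge)
  also have "\<dots> \<le> measure_pmf.expectation (G N) ?tr / (a - p N) ^ ?n"
    using \<open>p N < a\<close> integrable_measure_pmf_finite[OF finD]
    by (intro integral_Markov_inequality_measure AE_pmfI)
       (auto simp: power_trace_even[OF edge_matrix_sym] intro!: sum_nonneg ip_self_nonneg)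
  also have "\<dots> \<le> real N * (good_walk_const * (p N * real N) / c) ^ (2 ^ s) / (a - p N) ^ ?n"
    using ex \<open>p N < a\<close> by (intro divide_right_mono) auto
  also have "\<dots> = real N * (good_walk_const * (p N * real N) / c / (a - p N)\<^sup>2) ^ (2 ^ s)"
    by (simp only: power_divide power_mult times_divide_eq_right)
  finally show ?thesis .
qed

section \<open>The limit in the two regimes\<close>

lemma tendsto_prob_1I:
  assumes "\<forall>\<^sub>F N in sequentially. 1 - measure_pmf.prob (G N) (A N) \<le> \<epsilon> N" and "\<epsilon> \<longlonglongrightarrow> 0"
  shows "(\<lambda>N. measure_pmf.prob (G N) (A N)) \<longlonglongrightarrow> 1"
proof (rule tendsto_sandwich)
  show "\<forall>\<^sub>F N in sequentially. 1 - \<epsilon> N \<le> measure_pmf.prob (G N) (A N)"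
    using assms(1) by eventually_elim linarith
  show "(\<lambda>N. 1 - \<epsilon> N) \<longlonglongrightarrow> 1"
    using tendsto_diff[OF tendsto_const assms(2), of 1] by simp
qed auto

text \<open>For \<open>s = 1\<close> the failure probability is of order
  \<open>N * (p * N) ^ 2 / (\<alpha> - p) ^ 4\<close>, and \<open>sqrt p * N powr (3 / 4)\<close> is
  the fourth root of the numerator.\<close>

lemma jumbled_fourwise:
  assumes p: "\<And>N. 0 < p N \<and> p N < 1" and G: "kwise_indep_random_graph k p G"
    and k: "\<forall>\<^sub>F N in sequentially. 4 \<le> k N" and "p \<in> \<Omega>(\<lambda>N. 1 / real N)"
    and \<alpha>: "filterlim (\<lambda>N. \<alpha> N / (sqrt (p N) * real N powr (3 / 4))) at_top sequentially"
  shows "(\<lambda>N. measure_pmf.prob (G N) {E. jumbled (p N) (\<alpha> N) {1..N} E}) \<longlonglongrightarrow> 1"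
proof -
  obtain c0 where "0 < c0" and c0: "\<forall>\<^sub>F N in sequentially. c0 * norm (1 / real N) \<le> norm (p N)"
    using assms(4) by (auto elim: landau_omega.bigE)
  \<comment> \<open>The half exponent is \<open>2 ^ 1\<close>, whence \<open>c0 / 2\<close>; the
    walk bound also requires \<open>c \<le> 1\<close>.\<close>
  define c where "c = min 1 (c0 / 2)"
  have c: "0 < c" "c \<le> 1" "2 * c \<le> c0" using \<open>0 < c0\<close> by (auto simp: c_def)
  define q where "q N = \<alpha> N / (sqrt (p N) * real N powr (3 / 4))" for N
  let ?\<epsilon> = "\<lambda>x::real. (good_walk_const / c)\<^sup>2 / (x - 1) ^ 4"
  have "(?\<epsilon> \<longlongrightarrow> 0) at_top" by real_asymp
  then have lim: "(\<lambda>N. ?\<epsilon> (q N)) \<longlonglongrightarrow> 0"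
    using \<alpha> unfolding q_def by (rule filterlim_compose)
  have q2: "\<forall>\<^sub>F N in sequentially. 2 \<le> q N"
    using \<alpha> unfolding q_def filterlim_at_top by blast
  show ?thesis
  proof (rule tendsto_prob_1I[OF _ lim])
    show "\<forall>\<^sub>F N in sequentially. 1 - measure_pmf.prob (G N) {E. jumbled (p N) (\<alpha> N) {1..N} E} \<le> ?\<epsilon> (q N)"
      using k c0 q2 eventually_ge_at_top[of 1]
    proof eventually_elim
      case (elim N)
      define b where "b = sqrt (p N) * real N powr (3 / 4)"
      have "0 < b" using p[of N] elim by (simp add: b_def)
      have \<alpha>_eq: "\<alpha> N = q N * b"
        using \<open>0 < b\<close> by (simp add: q_def flip: b_def)
      \<comment> \<open>\<open>p N\<close> is at most the scale \<open>b\<close>, so passing from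
        \<open>\<alpha>\<close> to \<open>\<alpha> - p\<close> costs only 1 in the ratio
        \<open>q\<close>.\<close>
      have "p N * 1 \<le> b"
        unfolding b_def
      proof (rule mult_mono)
        show "p N \<le> sqrt (p N)"
          using p[of N] by (intro real_le_rsqrt) (simp add: power2_eq_square mult_left_le)
        show "1 \<le> real N powr (3 / 4)" using elim by (intro ge_one_powr_ge_zero) auto
      qed (use p[of N] in auto)
      then have diff: "(q N - 1) * b \<le> \<alpha> N - p N"
        by (simp add: \<alpha>_eq algebra_simps)
      have "1 * b \<le> (q N - 1) * b" using elim \<open>0 < b\<close> by (intro mult_right_mono) auto
      then have "p N < \<alpha> N" and pos: "0 < (q N - 1) * b" using diff \<open>0 < b\<close> by linarith+
      have b4: "b ^ 4 = real N * (p N * real N)\<^sup>2"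
      proof -
        have "(real N powr (3 / 4)) ^ 4 = real N ^ 3"
          using elim powr_power[of "real N" "3 / 4" 4] powr_realpow[of "real N" 3] by simp
        moreover have "sqrt (p N) ^ 4 = (p N)\<^sup>2"
          using p[of N] by (simp add: power4_eq_xxxx power2_eq_square)
        ultimately show ?thesis
          by (simp add: b_def power_mult_distrib power3_eq_cube power2_eq_square)
      qed
      have "c * 2 ^ 1 \<le> p N * real N"
      proof -
        have "c0 / real N \<le> p N" using elim p[of N] by simp
        then show ?thesis using c elim by (simp add: pos_divide_le_eq)
      qed
      then have "1 - measure_pmf.prob (G N) {E. jumbled (p N) (\<alpha> N) {1..N} E}
        \<le> real N * (good_walk_const * (p N * real N) / c / (\<alpha> N - p N)\<^sup>2) ^ (2 ^ 1)"
        using elim p[of N] c \<open>p N < \<alpha> N\<close> by (intro prob_not_jumbled_le[OF G]) auto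
      also have "\<dots> \<le> real N * (good_walk_const * (p N * real N) / c / ((q N - 1) * b)\<^sup>2) ^ (2 ^ 1)"
        using good_walk_const_ge_1 p[of N] c pos diff
        by (intro mult_left_mono power_mono frac_le zero_less_power) auto
      also have "\<dots> = (good_walk_const / c)\<^sup>2 * b ^ 4 / ((q N - 1) * b) ^ 4"
        unfolding b4 by (simp add: power2_eq_square power4_eq_xxxx mult_ac)
      also have "\<dots> = ?\<epsilon> (q N)"
        using \<open>0 < b\<close> by (simp add: power_mult_distrib)
      finally show ?case .
    qed
  qed
qed

text \<open>Exponents are restricted to powers of two; taking the largest one up to the floor of
  \<open>x / 2\<close> loses less than a factor 2.\<close>

lemma ex_power_of_two_between:
  fixes x :: real
  assumes "2 \<le> x"
  obtains s :: nat where "2 * 2 ^ s \<le> x" "x < 4 * 2 ^ s"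
proof -
  define j where "j = nat \<lfloor>x / 2\<rfloor>"
  have "1 \<le> j" using assms by (simp add: j_def le_nat_iff le_floor_iff)
  then obtain s where s: "2 ^ s \<le> j" "j < 2 ^ (s + 1)"
    using ex_power_ivl1[of 2 j] by auto
  have "real (2 ^ s) \<le> real j" "real (j + 1) \<le> real (2 * 2 ^ s)"
    unfolding of_nat_le_iff using s by simp_all
  then have "2 ^ s \<le> real j" "real j + 1 \<le> 2 * 2 ^ s"
    by simp_all
  moreover have "real j \<le> x / 2" "x / 2 < real j + 1"
    using assms unfolding j_def by linarith+
  ultimately have "2 * 2 ^ s \<le> x" "x < 4 * 2 ^ s" by linarith+
  then show ?thesis by (rule that)
qed

text \<open>The trace exponent lies between half of \<open>log 2 N\<close> and
  \<open>log 2 N\<close>, so \<open>k N\<close> permits it. The constant 16 makes the base at most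
  \<open>1 / 256\<close>, and \<open>256 ^ (2 ^ s)\<close> is at least \<open>N ^ 2\<close>, which
  beats the factor \<open>N\<close>.\<close>

lemma jumbled_logwise:
  assumes p: "\<And>N. 0 < p N \<and> p N < 1" and G: "kwise_indep_random_graph k p G"
    and ev: "\<forall>\<^sub>F N in sequentially. log 2 (real N) \<le> real (k N) \<and>
          log 2 (real N) / real N \<le> p N \<and> (1 + 16 * sqrt good_walk_const) * sqrt (p N * real N) \<le> \<alpha> N"
  shows "(\<lambda>N. measure_pmf.prob (G N) {E. jumbled (p N) (\<alpha> N) {1..N} E}) \<longlonglongrightarrow> 1"
proof (rule tendsto_prob_1I)
  show "(\<lambda>N. 1 / real N) \<longlonglongrightarrow> 0" by real_asymp
  let ?K = good_walk_const
  show "\<forall>\<^sub>F N in sequentially. 1 - measure_pmf.prob (G N) {E. jumbled (p N) (\<alpha> N) {1..N} E} \<le> 1 / real N"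
    \<comment> \<open>From \<open>N = 4\<close> on the logarithm is at least 2, so that a suitable
      \<open>s\<close> exists.\<close>
    using ev eventually_ge_at_top[of 4]
  proof eventually_elim
    case (elim N)
    define d where "d = p N * real N"
    have "0 < d" using p[of N] elim by (simp add: d_def)
    have "log 2 4 \<le> log 2 (real N)" using elim by simp
    moreover have "log 2 4 = (2 :: real)" using log_pow_cancel[of "2::real" 2] by simp
    ultimately have "2 \<le> log 2 (real N)" by simp
    then obtain s where s: "2 * 2 ^ s \<le> log 2 (real N)" "log 2 (real N) < 4 * 2 ^ s"
      using ex_power_of_two_between by blast
    have "real (2 * 2 ^ s) \<le> real (k N)" using s elim by simp
    then have k: "2 * 2 ^ s \<le> k N" by (simp only: of_nat_le_iff)
    have "log 2 (real N) \<le> d"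
      using elim by (simp add: d_def pos_divide_le_eq)
    then have d: "1 * 2 ^ s \<le> d" using s by simp
    \<comment> \<open>The summand 1 in \<open>1 + 16 * sqrt ?K\<close> pays for the diagonal
      correction \<open>p N\<close>.\<close>
    have "p N \<le> sqrt d"
    proof (rule real_le_rsqrt)
      show "(p N)\<^sup>2 \<le> d"
        unfolding d_def power2_eq_square using p[of N] elim by (intro mult_left_mono) auto
    qed
    moreover have "(1 + 16 * sqrt ?K) * sqrt d \<le> \<alpha> N"
      using elim by (simp only: d_def)
    ultimately have diff: "16 * sqrt ?K * sqrt d \<le> \<alpha> N - p N"
      by (simp add: algebra_simps)
    have K: "0 < ?K" using good_walk_const_ge_1 by simp
    then have pos: "0 < 16 * sqrt ?K * sqrt d" using \<open>0 < d\<close> by simp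
    then have "p N < \<alpha> N" using diff by linarith
    have "(16 * sqrt ?K * sqrt d)\<^sup>2 \<le> (\<alpha> N - p N)\<^sup>2"
      using diff pos by (intro power_mono) auto
    then have sq: "256 * (?K * d) \<le> (\<alpha> N - p N)\<^sup>2"
      using K \<open>0 < d\<close> by (simp add: power_mult_distrib)
    have "1 - measure_pmf.prob (G N) {E. jumbled (p N) (\<alpha> N) {1..N} E}
      \<le> real N * (?K * (p N * real N) / 1 / (\<alpha> N - p N)\<^sup>2) ^ (2 ^ s)"
      using p[of N] k \<open>p N < \<alpha> N\<close> d by (intro prob_not_jumbled_le[OF G]) (auto simp: d_def)
    also have "\<dots> \<le> real N * (1 / 256) ^ (2 ^ s)"
    proof (intro mult_left_mono power_mono)
      show "?K * (p N * real N) / 1 / (\<alpha> N - p N)\<^sup>2 \<le> 1 / 256"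
        using sq \<open>p N < \<alpha> N\<close> by (simp add: d_def[symmetric] pos_divide_le_eq)
    qed (use K p[of N] in auto)
    also have "\<dots> \<le> real N * (1 / (real N)\<^sup>2)"
    proof (intro mult_left_mono)
      have "real N = 2 powr log 2 (real N)" using elim by simp
      also have "\<dots> \<le> 2 powr real (4 * 2 ^ s)" using s by (intro powr_mono) auto
      also have "\<dots> = 2 ^ (4 * 2 ^ s)" by (rule powr_realpow) simp
      also have "\<dots> = (2 ^ 4) ^ (2 ^ s)" by (rule power_mult)
      also have "(2 :: real) ^ 4 = 16" by simp
      finally have "(real N)\<^sup>2 \<le> (16 ^ (2 ^ s))\<^sup>2" by (intro power_mono) auto
      also have "\<dots> = 256 ^ (2 ^ s)" by (simp add: power2_eq_square flip: power_mult_distrib)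
      finally show "(1 / 256) ^ (2 ^ s) \<le> 1 / (real N)\<^sup>2"
        using elim by (simp add: power_one_over divide_simps)
    qed auto
    also have "\<dots> = 1 / real N"
      using elim by (simp add: power2_eq_square)
    finally show ?case .
  qed
qed

theorem mainTheorem1:
  "\<exists>c1 c2 c3 :: real. c1 > 0 \<and> c2 > 0 \<and> c3 > 0 \<and>
    (\<forall>(k :: nat \<Rightarrow> nat) (p :: nat \<Rightarrow> real) (\<alpha> :: nat \<Rightarrow> real) (G :: nat \<Rightarrow> nat set set pmf).
      (\<forall>N. 0 < p N \<and> p N < 1) \<longrightarrow>
      (\<forall>N. 0 < \<alpha> N) \<longrightarrow>
      kwise_indep_random_graph k p G \<longrightarrow>
      ((\<forall>\<^sub>F N in sequentially. 4 \<le> k N) \<and>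
       p \<in> \<Omega>(\<lambda>N. 1 / real N) \<and>
       filterlim (\<lambda>N. \<alpha> N / (sqrt (p N) * real N powr (3 / 4))) at_top sequentially
       \<or>
       (\<forall>\<^sub>F N in sequentially.
          log 2 (real N) \<le> real (k N) \<and>
          c1 * log 2 (real N) / real N \<le> p N \<and>
          p N \<le> 1 - c2 * (log 2 (real N)) ^ 4 / real N \<and>
          c3 * sqrt (p N * real N) \<le> \<alpha> N)) \<longrightarrow>
      (\<lambda>N. measure_pmf.prob (G N) {E. jumbled (p N) (\<alpha> N) {1..N} E}) \<longlonglongrightarrow> 1)"
\<comment> \<open>The values of \<open>c1\<close> and \<open>c3\<close> are the constants of
  \<open>jumbled_logwise\<close>.\<close>
proof (rule exI[of _ 1], rule exI[of _ 1], rule exI[of _ "1 + 16 * sqrt good_walk_const"], intro conjI allI impI)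
  show "0 < 1 + 16 * sqrt good_walk_const"
    using good_walk_const_ge_1 by (simp add: add_pos_nonneg)
next
  fix k :: "nat \<Rightarrow> nat" and p \<alpha> :: "nat \<Rightarrow> real" and G :: "nat \<Rightarrow> nat set set pmf"
  assume p: "\<forall>N. 0 < p N \<and> p N < 1" and G: "kwise_indep_random_graph k p G"
    and "(\<forall>\<^sub>F N in sequentially. 4 \<le> k N) \<and>
       p \<in> \<Omega>(\<lambda>N. 1 / real N) \<and>
       filterlim (\<lambda>N. \<alpha> N / (sqrt (p N) * real N powr (3 / 4))) at_top sequentially
       \<or>
       (\<forall>\<^sub>F N in sequentially.
          log 2 (real N) \<le> real (k N) \<and>
          1 * log 2 (real N) / real N \<le> p N \<and>
          p N \<le> 1 - 1 * (log 2 (real N)) ^ 4 / real N \<and>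
          (1 + 16 * sqrt good_walk_const) * sqrt (p N * real N) \<le> \<alpha> N)"
  then show "(\<lambda>N. measure_pmf.prob (G N) {E. jumbled (p N) (\<alpha> N) {1..N} E}) \<longlonglongrightarrow> 1"
  proof (elim disjE conjE)
    assume "\<forall>\<^sub>F N in sequentially. 4 \<le> k N" "p \<in> \<Omega>(\<lambda>N. 1 / real N)"
      "filterlim (\<lambda>N. \<alpha> N / (sqrt (p N) * real N powr (3 / 4))) at_top sequentially"
    then show ?thesis using p G by (intro jumbled_fourwise) auto
  next
    assume "\<forall>\<^sub>F N in sequentially.
          log 2 (real N) \<le> real (k N) \<and>
          1 * log 2 (real N) / real N \<le> p N \<and>
          p N \<le> 1 - 1 * (log 2 (real N)) ^ 4 / real N \<and>
          (1 + 16 * sqrt good_walk_const) * sqrt (p N * real N) \<le> \<alpha> N"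
    then have "\<forall>\<^sub>F N in sequentially. log 2 (real N) \<le> real (k N) \<and>
          log 2 (real N) / real N \<le> p N \<and> (1 + 16 * sqrt good_walk_const) * sqrt (p N * real N) \<le> \<alpha> N"
      by eventually_elim simp
    then show ?thesis using p G by (intro jumbled_logwise) auto
  qed
qed simp_all

end
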